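(* Let $m$ and $q$ be positive integers, $\omega=\exp(2\pi i/m)$, and let $g:\mathbb{Z}\to\mathbb{C}$ be periodic of period $m$ (i.e. $g(n+m)=g(n)$ for all $n\in\mathbb{Z}$). Let $M(g)=\frac1m\sum_{n=0}^{m-1}g(n)$ and $L(s,g)=\sum_{n=1}^\infty g(n)n^{-s}$. If $\alpha$ and $\beta$ are positive real numbers satisfying $\alpha\beta=\pi^2$, then \[ \alpha^{-q+1/2}\bigg\{\tfrac12 L(2q,g) + \sum_{n=1}^\infty \frac{n^{-2q}g(n)}{e^{2n\alpha}-1}\bigg\} = (-1)^q \beta^{-q+1/2} i m^{-1} \sum_{k=1}^{m-1} g(k)\sum_{n=1}^\infty \frac{n^{-2q}}{e^{2n\beta/m}\omega^k -1} + \sum_{j=0}^q (-1)^{j+1}\alpha^{j-1/2-q}\beta^{-j}\zeta(2j)L(2q-2j+1,g) \] if $g$ is odd, and \[ \alpha^{-q}\bigg\{\tfrac12 L(2q+1,g)+\sum_{n=1}^{\infty} \frac{n^{-2q-1}g(n)}{e^{2n\alpha}-1}\bigg\} = (-\beta)^{-q}\bigg\{\tfrac12 M(g)\zeta(2q+1)+ \frac1m\sum_{k=0}^{m-1}g(k) \sum_{n=1}^\infty \frac{n^{-2q-1}}{e^{2n\beta/m}\omega^k-1}\bigg\} + \sum_{j=0}^{q+1} (-1)^{j+1}\alpha^{j-q-1}\beta^{-j}\zeta(2j)L(2q-2j+2,g) \] if $g$ is even. If $M(g)=0$, the latter formula (for even $g$) is also valid when $q=0$, with the term $\tfrac12 M(g)\zeta(1)$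 interpreted as $0$.
   Context: $\zeta$ denotes the Riemann zeta function, with $\zeta(0)=-\tfrac12$. The series $L(s,g)$ converges for $\Re(s)>1$, and for $\Re(s)>0$ when $M(g)=0$ (in particular whenever $g$ is odd); for odd $g$ the value $L(1,g)$ is given by the convergent series. For even $g$, $L(0,g)$ denotes the value at $s=0$ of the meromorphic continuation of $L(s,g)$, namely $L(0,g)=-\tfrac12 g(0)$. *)

theory Defs
  imports "HOL-Complex_Analysis.Complex_Analysis"
begin

definition dirichlet_term :: "(int \<Rightarrow> complex) \<Rightarrow> complex \<Rightarrow> nat \<Rightarrow> complex" where
  "dirichlet_term g s n = g (int (Suc n)) * of_nat (Suc n) powr (- s)"

(* At most one nicely meromorphic function on the plane extends a given function on the
   half-plane Re s > 1, because it is continuous off its poles and takes the value 0 at them.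
   If there is no such function, the value is unspecified. *)
definition meromorphic_continuation :: "(complex \<Rightarrow> complex) \<Rightarrow> complex \<Rightarrow> complex" where
  "meromorphic_continuation f =
     (THE F. F nicely_meromorphic_on UNIV \<and> (\<forall>s. Re s > 1 \<longrightarrow> F s = f s))"

(* L(s,g): the sum of the series wherever it converges, the continuation elsewhere.
   For periodic g the series converges for Re s > 1, and for Re s > 0 if g has mean 0;
   at s = 0 it diverges unless g = 0. *)
definition dirichlet_L :: "complex \<Rightarrow> (int \<Rightarrow> complex) \<Rightarrow> complex" where
  "dirichlet_L s g =
     (if summable (dirichlet_term g s) then (\<Sum>n. dirichlet_term g s n)
      else meromorphic_continuation (\<lambda>z. \<Sum>n. dirichlet_term g z n) s)"

(* At the pole s = 1 this has the value 0. *)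
definition riemann_zeta :: "complex \<Rightarrow> complex" where
  "riemann_zeta s = dirichlet_L s (\<lambda>_. 1)"

definition periodic_mean :: "nat \<Rightarrow> (int \<Rightarrow> complex) \<Rightarrow> complex" where
  "periodic_mean m g = (\<Sum>n<m. g (int n)) / of_nat m"

end

theory Submission
  imports Defs
begin

text \<open>
  Write $D(n,k) = \alpha n^2 + \beta k^2$. Since $\alpha\beta = \pi^2$, the partial fractions of the
  hyperbolic cotangent read
  $\frac12 + \frac1{e^{2n\alpha}-1} = \frac1{2n\alpha} + \sum_{k\ge1} n/D(n,k)$.
  Substituting this on the left-hand side and expanding $n^{-2q}/D(n,k)$ as a finite geometric sum
  produces the products $\zeta(2j)L(\cdot,g)$ and the remainder
  $(-\alpha/\beta)^q \sum_n \sum_k g(n) n^\epsilon k^{-2q}/D(n,k)$, with $\epsilon = 1$ for odd and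
  $\epsilon = 0$ for even $g$. Exchanging the two sums, the inner sum over $n$ is evaluated, residue class
  by residue class, by the partial fractions of the cotangent; this gives the series in $\omega^k$. The
  exchange is only conditional when $g$ has mean $0$ and $\epsilon = 1$ or $q = 0$; collecting the terms
  $n$ in blocks of length $m$ makes it absolute, because the sum of $g$ over a block vanishes.

  The values $\zeta(0)$ and $L(0,g)$ come from the continuation of the Hurwitz zeta function obtained by
  repeated integration by parts, for which $\zeta(0,a) = \frac12 - a$.
\<close>

section \<open>Analytic continuation\<close>

text \<open>Apart from the two values at 0, all the series involved converge. But
  \<open>meromorphic_continuation\<close> is a definite description, so even a single value of it
  requires a nicely meromorphic function on the whole plane together with its uniqueness. For this
  reason integration by parts is carried to arbitrary depth, although one step of the recursion
  already reaches 0. Parity makes the inner sum over n computable: the cotangent delivers a sum over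
  n and -n, and g(-n) = g(n) or -g(n) folds it onto n >= 1, with numerator 1 or n respectively. The
  folding misses the index n = 0. Half of its term, g(0)/(2 \<beta> k^2), therefore appears as a
  correction in the even case. Summed over k it becomes a multiple of \<zeta>(2q+2), and since
  L(0,g) = -g(0)/2 it is the summand j = q+1, which the geometric sum alone does not produce. For
  odd g this correction vanishes with g(0), so the sum stops at j = q.\<close>

definition wint :: "real \<Rightarrow> (real \<Rightarrow> complex) \<Rightarrow> nat \<Rightarrow> complex \<Rightarrow> complex" where
  "wint a p n s = integral {0..1} (\<lambda>x. p x * complex_of_real (real n + a + x) powr (- s))"

lemma continuous_on_shift_powr:
  assumes "a > 0"
  shows "continuous_on {0..1} (\<lambda>x. complex_of_real (real n + a + x) powr s)"
  using assms by (intro continuous_intros) (auto simp: complex_eq_iff)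

lemma wint_integrand_continuous:
  assumes "a > 0" "continuous_on {0..1} p"
  shows "continuous_on {0..1} (\<lambda>x. p x * complex_of_real (real n + a + x) powr s)"
  by (intro continuous_intros continuous_on_shift_powr assms)

lemma wint_holomorphic:
  assumes "a > 0" "continuous_on {0..1} p"
  shows "wint a p n holomorphic_on UNIV"
proof -
  define w where "w = (\<lambda>x. complex_of_real (real n + a + x))"
  have w: "w x \<noteq> 0" "w x \<notin> \<real>\<^sub>\<le>\<^sub>0" "Re (w x) \<ge> 0" if "x \<in> {0..1}" for x
    using assms that by (auto simp: w_def complex_nonpos_Reals_iff complex_eq_iff)
  have contw: "continuous_on {0..1} w" unfolding w_def by (intro continuous_intros)
  have "(\<lambda>s. integral (cbox 0 1) (\<lambda>x. p x * w x powr (- s))) holomorphic_on UNIV"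
  proof (rule leibniz_rule_holomorphic[where fx = "\<lambda>s x. p x * (- (Ln (w x) * w x powr (- s)))"])
    show "((\<lambda>s. p t * w t powr - s) has_field_derivative p t * - (Ln (w t) * w t powr - x)) (at x within UNIV)"
      if "t \<in> cbox 0 1" for x t
      using w[of t] that
      by (auto intro!: derivative_eq_intros DERIV_chain2[OF has_field_derivative_powr_right])
    show "(\<lambda>x. p x * w x powr - s) integrable_on cbox 0 1" for s
      using wint_integrand_continuous[OF assms, of n "-s"]
      by (auto simp: w_def intro!: integrable_continuous_real)
    show "continuous_on (UNIV \<times> cbox 0 1) (\<lambda>(s, t). p t * - (Ln (w t) * w t powr - s))"
      unfolding split_def
      by (intro continuous_intros continuous_on_compose2[OF assms(2)] continuous_on_compose2[OF contw])
         (use w in auto)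
  qed auto
  thus ?thesis by (simp add: wint_def[abs_def] w_def)
qed

text \<open>Uniform in \<open>s\<close> on a half-plane, as the M-test for the series requires. The
  base \<open>n + a + x\<close> is bounded below by \<open>n\<close>, hence
  \<open>n > 0\<close>.\<close>

lemma norm_wint_le:
  assumes "a > 0" "continuous_on {0..1} p" "\<And>x. x \<in> {0..1} \<Longrightarrow> norm (p x) \<le> C"
    and "n > 0" "Re s \<ge> \<sigma>" "\<sigma> \<ge> 0"
  shows "norm (wint a p n s) \<le> C * real n powr (- \<sigma>)"
proof -
  have "norm (p x * complex_of_real (real n + a + x) powr (- s)) \<le> C * real n powr (- \<sigma>)"
    if x: "x \<in> {0..1}" for x
  proof -
    have "norm (complex_of_real (real n + a + x) powr (- s)) = (real n + a + x) powr (- Re s)"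
      using assms x by (subst norm_powr_real_powr) auto
    also have "\<dots> \<le> real n powr (- Re s)"
      using assms x by (intro powr_mono2') auto
    also have "\<dots> \<le> real n powr (- \<sigma>)"
      using assms by (intro powr_mono) auto
    finally show ?thesis
      using assms(3)[OF x] unfolding norm_mult
      by (intro mult_mono) (auto intro: order_trans[OF norm_ge_zero])
  qed
  hence "norm (wint a p n s) \<le> C * real n powr (- \<sigma>) * (1 - 0)"
    unfolding wint_def
    by (intro integral_bound wint_integrand_continuous assms) auto
  thus ?thesis by simp
qed

lemma continuous_unit_bound:
  fixes p :: "real \<Rightarrow> complex"
  assumes "continuous_on {0..1} p"
  obtains C where "\<And>x. x \<in> {0..1} \<Longrightarrow> norm (p x) \<le> C" "C \<ge> 0"
proof -
  have "bounded (p ` {0..1})"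
    using assms by (intro compact_imp_bounded compact_continuous_image) auto
  then obtain C where "\<And>x. x \<in> {0..1} \<Longrightarrow> norm (p x) \<le> C" 
    unfolding bounded_iff by blast
  moreover from this[of 0] have "C \<ge> 0" by (auto intro: order_trans[OF norm_ge_zero])
  ultimately show ?thesis using that by blast
qed

lemma summable_wint:
  assumes "a > 0" "continuous_on {0..1} p" "Re s > 1"
  shows "summable (\<lambda>n. wint a p n s)"
proof -
  obtain C where C: "\<And>x. x \<in> {0..1} \<Longrightarrow> norm (p x) \<le> C" using continuous_unit_bound assms by blast
  show ?thesis
  proof (rule summable_comparison_test_ev)
    show "\<forall>\<^sub>F n in sequentially. norm (wint a p n s) \<le> C * real n powr (- Re s)"
      using eventually_gt_at_top[of 0]
      by eventually_elim (intro norm_wint_le assms C, use assms in auto)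
    show "summable (\<lambda>n. C * real n powr (- Re s))"
      using assms by (intro summable_mult) (simp add: summable_real_powr_iff)
  qed
qed

lemma wint_series_holomorphic:
  assumes "a > 0" "continuous_on {0..1} p"
  shows "(\<lambda>s. \<Sum>n. wint a p n s) holomorphic_on {s. Re s > 1}"
proof (rule holomorphic_uniform_sequence[where f = "\<lambda>N s. \<Sum>n<N. wint a p n s"])
  show "open {s. Re s > 1}" by (rule open_halfspace_Re_gt)
  show "(\<lambda>s. \<Sum>n<N. wint a p n s) holomorphic_on {s. Re s > 1}" for N
    by (intro holomorphic_intros holomorphic_on_subset[OF wint_holomorphic[OF assms]]) auto
  fix x assume x: "x \<in> {s. Re s > 1}"
  \<comment> \<open>Half the distance to the line Re s = 1, so the closed disc stays in Re s >= 1 +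
    d.\<close>
  define d where "d = (Re x - 1) / 2"
  have d: "d > 0" using x by (simp add: d_def)
  obtain C where C: "\<And>x. x \<in> {0..1} \<Longrightarrow> norm (p x) \<le> C" using continuous_unit_bound assms by blast
  have Re: "Re s \<ge> 1 + d" if "s \<in> cball x d" for s
    using that abs_Re_le_cmod[of "x - s"] unfolding dist_norm mem_cball
    by (simp add: d_def field_simps)
  have "uniform_limit (cball x d) (\<lambda>N s. \<Sum>n<N. wint a p n s) (\<lambda>s. \<Sum>n. wint a p n s) sequentially"
  proof (rule Weierstrass_m_test_ev)
    show "\<forall>\<^sub>F n in sequentially. \<forall>s\<in>cball x d. norm (wint a p n s) \<le> C * real n powr (- (1 + d))"
      using eventually_gt_at_top[of 0]
      by eventually_elim (intro ballI norm_wint_le assms C Re, use d in auto)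
    show "summable (\<lambda>n. C * real n powr (- (1 + d)))"
      using d by (intro summable_mult) (simp add: summable_real_powr_iff)
  qed
  thus "\<exists>d>0. cball x d \<subseteq> {s. Re s > 1} \<and> uniform_limit (cball x d)
          (\<lambda>N s. \<Sum>n<N. wint a p n s) (\<lambda>s. \<Sum>n. wint a p n s) sequentially"
    using d Re by (intro exI[of _ d]) fastforce
qed

text \<open>Once the mean is removed, \<open>p\<close> has a primitive vanishing at both ends of the
  unit interval, so integration by parts leaves no boundary terms. Started from
  \<open>1 - x\<close>, the iterates are constant multiples of B_n(x) - B_n(0), the kernels of
  Euler-Maclaurin summation.\<close>

definition centred_primitive :: "(real \<Rightarrow> complex) \<Rightarrow> real \<Rightarrow> complex" where
  "centred_primitive p x = integral {0..x} p - of_real x * integral {0..1} p"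

lemma centred_primitive_ends [simp]: "centred_primitive p 0 = 0" "centred_primitive p 1 = 0"
  by (simp_all add: centred_primitive_def)

lemma centred_primitive_derivative:
  assumes "continuous_on {0..1} p" "x \<in> {0..1}"
  shows "(centred_primitive p has_vector_derivative p x - integral {0..1} p) (at x within {0..1})"
  unfolding centred_primitive_def[abs_def]
  by (rule derivative_eq_intros integral_has_vector_derivative[OF assms] refl | simp)+

lemma continuous_on_centred_primitive:
  assumes "continuous_on {0..1} p"
  shows "continuous_on {0..1} (centred_primitive p)"
  using centred_primitive_derivative[OF assms]
  by (meson continuous_on_eq_continuous_within has_vector_derivative_continuous)

lemma shift_powr_derivative:
  assumes "a > 0" "x \<ge> 0"
  shows "((\<lambda>x. complex_of_real (real n + a + x) powr s) has_vector_derivative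
           s * complex_of_real (real n + a + x) powr (s - 1)) (at x within A)"
proof -
  have "((\<lambda>z. (of_real (real n + a) + z) powr s) has_field_derivative
          s * (of_real (real n + a) + of_real x) powr (s - 1)) (at (of_real x))"
    using assms by (auto intro!: derivative_eq_intros simp: complex_nonpos_Reals_iff)
  hence "((\<lambda>z. (of_real (real n + a) + z) powr s) has_field_derivative
          s * (of_real (real n + a) + of_real x) powr (s - 1)) (at (of_real x) within of_real ` A)"
    by (rule has_field_derivative_at_within)
  moreover have "(complex_of_real has_vector_derivative 1) (at x within A)"
    by (auto intro!: derivative_eq_intros)
  ultimately show ?thesis
    using field_vector_diff_chain_within[of of_real 1 x A] by (force simp: o_def add_ac)
qed

lemma wint_by_parts:
  assumes a: "a > 0" and p: "continuous_on {0..1} p"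
    and P: "continuous_on {0..1} P" "\<And>x. x \<in> {0..1} \<Longrightarrow> (P has_vector_derivative p x) (at x within {0..1})"
  shows "wint a p n s = P 1 * complex_of_real (real n + a + 1) powr (- s)
           - P 0 * complex_of_real (real n + a) powr (- s) + s * wint a P n (s + 1)"
proof -
  let ?w = "\<lambda>x. complex_of_real (real n + a + x)"
  have "((\<lambda>x. P x * (- s * ?w x powr (- s - 1)) + p x * ?w x powr (- s)) has_integral
          P 1 * ?w 1 powr (- s) - P 0 * ?w 0 powr (- s)) {0..1}"
    by (intro fundamental_theorem_of_calculus has_vector_derivative_mult P shift_powr_derivative a) auto
  moreover have "((\<lambda>x. P x * ?w x powr (- (s + 1))) has_integral wint a P n (s + 1)) {0..1}"
    unfolding wint_def
    by (intro integrable_integral integrable_continuous_real wint_integrand_continuous a P)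
  hence "((\<lambda>x. s * (P x * ?w x powr (- (s + 1)))) has_integral s * wint a P n (s + 1)) {0..1}"
    by (rule has_integral_mult_right)
  ultimately have "((\<lambda>x. (P x * (- s * ?w x powr (- s - 1)) + p x * ?w x powr (- s)) + 
       s * (P x * ?w x powr (- (s + 1)))) has_integral
      (P 1 * ?w 1 powr (- s) - P 0 * ?w 0 powr (- s)) + s * wint a P n (s + 1)) {0..1}"
    by (rule has_integral_add)
  also have "(\<lambda>x. (P x * (- s * ?w x powr (- s - 1)) + p x * ?w x powr (- s)) + 
       s * (P x * ?w x powr (- (s + 1)))) = (\<lambda>x. p x * ?w x powr (- s))"
    by (auto simp: algebra_simps minus_diff_commute)
  finally show ?thesis by (simp add: wint_def integral_unique)
qed

lemma shift_powr_tendsto_0: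
  assumes "Re s > 0"
  shows "(\<lambda>n. complex_of_real (real n + a) powr (- s)) \<longlonglongrightarrow> 0"
proof (rule tendsto_norm_zero_cancel)
  have "(\<lambda>n. (real n + a) powr (- Re s)) \<longlonglongrightarrow> 0"
    using assms
    by (intro tendsto_neg_powr) (use filterlim_tendsto_add_at_top[OF tendsto_const[of a] filterlim_real_sequentially] 
         in \<open>auto simp: add_ac\<close>)
  moreover have "\<forall>\<^sub>F n in sequentially. norm (complex_of_real (real n + a) powr (- s)) = (real n + a) powr (- Re s)"
    using eventually_ge_at_top[of "nat \<lceil>\<bar>a\<bar>\<rceil>"]
    by eventually_elim (subst norm_powr_real_powr; auto; linarith)
  ultimately show "(\<lambda>n. norm (complex_of_real (real n + a) powr (- s))) \<longlonglongrightarrow> 0"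
    by (simp add: filterlim_cong)
qed

lemma wint_const_sums:
  assumes a: "a > 0" and s: "Re s > 1"
  shows "(\<lambda>n. wint a (\<lambda>_. c) n s) sums (c * of_real a powr (1 - s) / (s - 1))"
proof -
  let ?u = "\<lambda>n. c * complex_of_real (real n + a) powr (- (s - 1)) / (1 - s)"
  have ns: "1 - s \<noteq> 0" using s by auto
  have "wint a (\<lambda>_. c) n s = ?u (Suc n) - ?u n" for n
  proof -
    have "((\<lambda>x. c / (1 - s) * ((1 - s) * complex_of_real (real n + a + x) powr (1 - s - 1))) has_integral
            c / (1 - s) * (complex_of_real (real n + a + 1) powr (1 - s) - complex_of_real (real n + a + 0) powr (1 - s))) {0..1}"
      by (intro has_integral_mult_right fundamental_theorem_of_calculus shift_powr_derivative a) auto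
    hence "((\<lambda>x. c * complex_of_real (real n + a + x) powr (- s)) has_integral ?u (Suc n) - ?u n) {0..1}"
      using ns by (simp add: add_ac right_diff_distrib diff_divide_distrib)
    thus ?thesis unfolding wint_def by (rule integral_unique)
  qed
  moreover have "?u \<longlonglongrightarrow> c * 0 / (1 - s)"
    by (intro tendsto_intros shift_powr_tendsto_0) (use s ns in auto)
  hence "(\<lambda>n. ?u (Suc n) - ?u n) sums (0 - ?u 0)" by (intro telescope_sums) simp
  moreover have "0 - ?u 0 = c * of_real a powr (1 - s) / (s - 1)"
    using ns by (simp add: field_simps)
  ultimately show ?thesis by simp
qed

text \<open>Split \<open>p\<close> into its mean and the rest. The mean sums in closed form and
  carries the pole at s = 1; the rest is integrated by parts without boundary terms and gains one
  power of decay.\<close>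

lemma wint_series_recursion:
  assumes a: "a > 0" and p: "continuous_on {0..1} p" and s: "Re s > 1"
  shows "(\<Sum>n. wint a p n s) = integral {0..1} p * of_real a powr (1 - s) / (s - 1)
           + s * (\<Sum>n. wint a (centred_primitive p) n (s + 1))"
proof -
  define c where "c = integral {0..1} p"
  have "wint a p n s = wint a (\<lambda>_. c) n s + s * wint a (centred_primitive p) n (s + 1)" for n
  proof -
    have "wint a (\<lambda>x. p x - c) n s = s * wint a (centred_primitive p) n (s + 1)"
      using wint_by_parts[OF a _ continuous_on_centred_primitive[OF p] centred_primitive_derivative[OF p],
          of n s] continuous_on_diff[OF p continuous_on_const[of _ c]] by (simp add: c_def)
    moreover have "wint a (\<lambda>x. p x - c) n s = wint a p n s - wint a (\<lambda>_. c) n s"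
      unfolding wint_def left_diff_distrib
      by (intro integral_diff integrable_continuous_real wint_integrand_continuous a p continuous_intros)
    ultimately show ?thesis by (simp add: algebra_simps)
  qed
  moreover have "summable (\<lambda>n. wint a (centred_primitive p) n (s + 1))"
    by (intro summable_wint a continuous_on_centred_primitive p) (use s in auto)
  hence "(\<lambda>n. s * wint a (centred_primitive p) n (s + 1)) sums (s * (\<Sum>n. wint a (centred_primitive p) n (s + 1)))"
    by (intro sums_mult summable_sums)
  ultimately show ?thesis
    using sums_add[OF wint_const_sums[OF a s, of c]] by (simp add: sums_iff c_def)
qed

text \<open>
  Integration by parts trades $s$ for $s+1$, so the $N$-th step is meaningful for $\Re s > 1 - N$.
\<close>
primrec wint_cont :: "real \<Rightarrow> nat \<Rightarrow> (real \<Rightarrow> complex) \<Rightarrow> complex \<Rightarrow> complex" where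
  "wint_cont a 0 p s = (\<Sum>n. wint a p n s)"
| "wint_cont a (Suc N) p s = integral {0..1} p * of_real a powr (1 - s) / (s - 1)
     + s * wint_cont a N (centred_primitive p) (s + 1)"

lemma wint_cont_meromorphic:
  assumes "a > 0" "continuous_on {0..1} p"
  shows "wint_cont a N p meromorphic_on {s. Re s > 1 - real N}"
  using assms(2)
proof (induction N arbitrary: p)
  case 0
  show ?case using wint_series_holomorphic[OF assms(1) 0]
    by (auto intro!: analytic_on_imp_meromorphic_on simp: analytic_on_open open_halfspace_Re_gt)
next
  case (Suc N)
  have "(\<lambda>s. wint_cont a N (centred_primitive p) (s + 1)) meromorphic_on {s. Re s > 1 - real (Suc N)}"
    by (rule meromorphic_on_compose[OF Suc.IH[OF continuous_on_centred_primitive[OF Suc.prems]]])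
       (auto intro!: analytic_intros)
  moreover have "(\<lambda>s. complex_of_real a powr (1 - s)) meromorphic_on A" for A
    using assms(1) by (intro analytic_on_imp_meromorphic_on analytic_intros) auto
  ultimately show ?case by (auto intro!: meromorphic_intros)
qed

text \<open>Both depths unfold through the same first steps, so they differ only at the innermost
  series, where one more application of \<open>wint_series_recursion\<close> is exact.\<close>

lemma wint_cont_Suc:
  assumes "a > 0" "continuous_on {0..1} p" "Re s > 1 - real N"
  shows "wint_cont a (Suc N) p s = wint_cont a N p s"
  using assms(2,3)
proof (induction N arbitrary: p s)
  case 0
  thus ?case using wint_series_recursion[OF assms(1) 0(1)] by simp
next
  case (Suc N)
  from Suc.IH[OF continuous_on_centred_primitive[OF Suc.prems(1)], of "s + 1"] Suc.prems(2)
  show ?case by simp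
qed

lemma wint_cont_mono:
  assumes "a > 0" "continuous_on {0..1} p" "N \<le> M" "Re s > 1 - real N"
  shows "wint_cont a M p s = wint_cont a N p s"
  using assms(3)
proof (induction M rule: dec_induct)
  case (step M)
  thus ?case using wint_cont_Suc[OF assms(1,2), of M s] assms(4) by (simp del: wint_cont.simps)
qed auto

text \<open>No fixed depth reaches the whole plane, so the depth depends on \<open>s\<close>. The 2
  instead of 1 leaves \<open>s\<close> at distance at least 1 inside the half-plane on which that
  depth is valid.\<close>

definition wint_ext :: "real \<Rightarrow> (real \<Rightarrow> complex) \<Rightarrow> complex \<Rightarrow> complex" where
  "wint_ext a p s = wint_cont a (nat \<lceil>2 - Re s\<rceil>) p s"

lemma wint_ext_eq:
  assumes "a > 0" "continuous_on {0..1} p" "Re s > 1 - real N"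
  shows "wint_ext a p s = wint_cont a N p s"
proof -
  define M where "M = nat \<lceil>2 - Re s\<rceil>"
  have M: "Re s > 1 - real M" unfolding M_def by linarith
  show ?thesis
    unfolding wint_ext_def M_def[symmetric]
    using wint_cont_mono[OF assms(1,2), of M "max M N" s] wint_cont_mono[OF assms(1,2), of N "max M N" s] assms(3) M
    by simp
qed

text \<open>Meromorphy is local, and near a given point the depth can be frozen at the value chosen
  for that point.\<close>

lemma wint_ext_meromorphic:
  assumes "a > 0" "continuous_on {0..1} p"
  shows "wint_ext a p meromorphic_on UNIV"
  unfolding meromorphic_on_meromorphic_at[of _ UNIV]
proof
  fix s :: complex
  define N where "N = nat \<lceil>2 - Re s\<rceil>"
  have N: "Re s > 1 - real N" unfolding N_def by linarith
  have "open {z. Re z > 1 - real N}" by (rule open_halfspace_Re_gt)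
  hence "\<forall>\<^sub>F z in at s. z \<in> {z. Re z > 1 - real N}"
    using N by (intro eventually_at_in_open') auto
  hence "\<forall>\<^sub>F z in at s. wint_ext a p z = wint_cont a N p z"
    by eventually_elim (auto intro!: wint_ext_eq assms)
  moreover have "wint_cont a N p meromorphic_on {s}"
    by (rule meromorphic_on_subset[OF wint_cont_meromorphic[OF assms]]) (use N in auto)
  ultimately show "wint_ext a p meromorphic_on {s}"
    by (subst meromorphic_on_cong[where g = "wint_cont a N p"]) auto
qed

section \<open>The Hurwitz zeta function and its value at 0\<close>

definition hurwitz_ext :: "real \<Rightarrow> complex \<Rightarrow> complex" where
  "hurwitz_ext a s = of_real a powr (1 - s) / (s - 1) + s * wint_ext a (\<lambda>x. of_real (1 - x)) (s + 1)"

lemma continuous_on_one_minus: "continuous_on A (\<lambda>x. complex_of_real (1 - x))"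
  by (intro continuous_intros)

lemma hurwitz_ext_meromorphic:
  assumes "a > 0"
  shows "hurwitz_ext a meromorphic_on UNIV"
proof -
  have "(\<lambda>s. wint_ext a (\<lambda>x. of_real (1 - x)) (s + 1)) meromorphic_on UNIV"
    by (rule meromorphic_on_compose[OF wint_ext_meromorphic[OF assms continuous_on_one_minus]])
       (auto intro!: analytic_intros)
  moreover have "(\<lambda>s. complex_of_real a powr (1 - s)) meromorphic_on UNIV"
    using assms(1) by (intro analytic_on_imp_meromorphic_on analytic_intros) auto
  ultimately show ?thesis unfolding hurwitz_ext_def[abs_def] by (auto intro!: meromorphic_intros)
qed

lemma hurwitz_ext_sums:
  assumes a: "a > 0" and s: "Re s > 1"
  shows "(\<lambda>n. of_real (real n + a) powr (- s)) sums hurwitz_ext a s"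
proof -
  let ?p = "\<lambda>x. complex_of_real (1 - x)"
  have "(\<lambda>n. wint a ?p n (s + 1)) sums wint_ext a ?p (s + 1)"
    using summable_wint[OF a continuous_on_one_minus, of "s + 1"] s
    by (subst wint_ext_eq[OF a continuous_on_one_minus, of 0]) (auto simp: summable_sums)
  moreover have "of_real (real n + a) powr (- s) = wint a (\<lambda>_. 1) n s + s * wint a ?p n (s + 1)" for n
  proof -
    \<comment> \<open>The primitive \<open>x - 1\<close> of the constant 1 vanishes at the right
      end, so integration by parts isolates the single term
      \<open>(n + a) powr (- s)\<close>.\<close>
    have "wint a (\<lambda>_. 1) n s = (- ?p 1) * complex_of_real (real n + a + 1) powr (- s)
           - (- ?p 0) * complex_of_real (real n + a) powr (- s) + s * wint a (\<lambda>x. - ?p x) n (s + 1)"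
      by (rule wint_by_parts[OF a]) (auto intro!: continuous_intros derivative_eq_intros)
    moreover have "wint a (\<lambda>x. - ?p x) n (s + 1) = - wint a ?p n (s + 1)"
      by (simp add: wint_def del: of_real_diff)
    ultimately show ?thesis by (simp add: algebra_simps)
  qed
  ultimately show ?thesis
    using sums_add[OF wint_const_sums[OF a s, of 1] sums_mult] by (simp add: hurwitz_ext_def)
qed

lemma integral_one_minus: "integral {0..1} (\<lambda>x. complex_of_real (1 - x)) = 1 / 2"
proof -
  have "((\<lambda>x. complex_of_real (1 - x)) has_integral
          (of_real (1 - 1\<^sup>2 / 2) - of_real (0 - 0\<^sup>2 / 2))) {0..1}"
    by (rule fundamental_theorem_of_calculus[where f = "\<lambda>x. of_real (x - x\<^sup>2 / 2)"])
       (auto intro!: derivative_eq_intros has_vector_derivative_of_real simp del: of_real_diff)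
  thus ?thesis by (simp add: integral_unique)
qed

text \<open>The mean 1/2 of \<open>1 - x\<close> gives \<open>wint_ext\<close> a pole at s + 1 = 1,
  which the factor \<open>s\<close> cancels, leaving 1/2; the first summand tends to -a. A limit is
  stated because the literal value \<open>hurwitz_ext a 0\<close> is -a: there the factor
  \<open>s\<close> annihilates the second summand.\<close>

lemma hurwitz_ext_tendsto_0:
  assumes a: "a > 0"
  shows "hurwitz_ext a \<midarrow>0\<rightarrow> 1 / 2 - of_real a"
proof -
  let ?p = "\<lambda>x. complex_of_real (1 - x)"
  define W where "W = (\<lambda>s. \<Sum>n. wint a (centred_primitive ?p) n s)"
  have op: "open {s. Re s > 1}" by (rule open_halfspace_Re_gt)
  have "W holomorphic_on {s. Re s > 1}"
    unfolding W_def by (intro wint_series_holomorphic a continuous_on_centred_primitive continuous_on_one_minus)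
  hence "isCont W 2"
    using op by (intro continuous_on_interior[OF holomorphic_on_imp_continuous_on]) (auto simp: interior_open)
  hence "W \<midarrow>0 + 2\<rightarrow> W (0 + 2)" by (simp add: isCont_def)
  hence "(\<lambda>s. W (s + 2)) \<midarrow>0\<rightarrow> W 2"
    using LIM_offset[of W "W 2" 2 2] by simp
  hence "(\<lambda>s. of_real a powr (1 - s) / (s - 1) + (of_real a powr (- s) / 2 + s * (s + 1) * W (s + 2))) 
           \<midarrow>0\<rightarrow> of_real a powr (1 - 0) / (0 - 1) + (of_real a powr (- 0) / 2 + 0 * (0 + 1) * W 2)"
    using a by (intro tendsto_intros) auto
  also have "of_real a powr (1 - 0) / (0 - 1) + (of_real a powr (- 0) / 2 + 0 * (0 + 1) * W 2) = 1 / 2 - of_real a"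
    using a by simp
  finally have lim: "(\<lambda>s. of_real a powr (1 - s) / (s - 1) + (of_real a powr (- s) / 2 + s * (s + 1) * W (s + 2))) 
           \<midarrow>0\<rightarrow> 1 / 2 - of_real a" .
  have "\<forall>\<^sub>F s in at (0::complex). s \<in> {s. Re s > - 1} - {0}"
    by (intro eventually_at_in_open) (auto intro: open_halfspace_Re_gt)
  hence "\<forall>\<^sub>F s in at 0. of_real a powr (1 - s) / (s - 1) + (of_real a powr (- s) / 2 + s * (s + 1) * W (s + 2))
           = hurwitz_ext a s"
  proof eventually_elim
    case (elim s)
    have "wint_ext a ?p (s + 1) = of_real a powr (- s) / (2 * s) + (s + 1) * W (s + 2)"
      using elim
      by (subst wint_ext_eq[OF a continuous_on_one_minus, of 1])
         (auto simp: W_def integral_one_minus add_ac simp del: of_real_diff)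
    thus ?case using elim unfolding hurwitz_ext_def by (simp add: distrib_left mult.assoc)
  qed
  with lim show ?thesis by (rule Lim_transform_eventually)
qed

section \<open>Periodic coefficients and the continuation of their Dirichlet series\<close>

lemma periodic_add_mult:
  assumes "\<And>n. g (n + int m) = g n"
  shows "g (n + int k * int m) = g n"
proof (induction k)
  case (Suc k)
  thus ?case using assms[of "n + int k * int m"] by (simp add: algebra_simps)
qed auto

lemma periodic_nat_shift:
  assumes "\<And>n. g (n + int m) = g n"
  shows "g (int (k * m + i)) = g (int i)"
  using periodic_add_mult[of g m "int i" k] assms by (simp add: add.commute)

lemma periodic_bounded:
  assumes "m > 0" "\<And>n. g (n + int m) = (g n :: complex)"
  obtains G where "G > 0" "\<And>n. norm (g (int n)) \<le> G"
proof -
  define G where "G = 1 + (\<Sum>i<m. norm (g (int i)))"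
  have "norm (g (int n)) \<le> G" for n
  proof -
    have "g (int n) = g (int (n mod m))"
      using periodic_nat_shift[of g m "n div m" "n mod m"] assms by simp
    also have "norm \<dots> \<le> (\<Sum>i<m. norm (g (int i)))"
      using assms(1) by (intro member_le_sum) auto
    finally show ?thesis by (simp add: G_def)
  qed
  moreover have "G > 0" by (simp add: G_def add_pos_nonneg sum_nonneg)
  ultimately show ?thesis using that by blast
qed

lemma sums_blocks:
  fixes f :: "nat \<Rightarrow> 'a :: real_normed_vector"
  assumes "f sums s" "m > 0"
  shows "(\<lambda>l. \<Sum>i<m. f (l * m + i)) sums s"
proof -
  have "sum f {l * m..<l * m + m} = (\<Sum>i<m. f (l * m + i))" for l
    by (rule sum.reindex_bij_witness[of _ "\<lambda>i. l * m + i" "\<lambda>i. i - l * m"]) auto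
  thus ?thesis using sums_group[OF assms] by (simp only:)
qed

lemma summable_dirichlet_term:
  assumes "m > 0" "\<And>n. g (n + int m) = g n" "Re s > 1"
  shows "summable (\<lambda>n. norm (dirichlet_term g s n))"
proof -
  obtain G where G: "\<And>n. norm (g (int n)) \<le> G" using periodic_bounded[of m g, OF assms(1,2)] by blast
  have "summable (\<lambda>n. real (Suc n) powr (- Re s))"
    using assms(3) summable_Suc_iff[of "\<lambda>n. real n powr (- Re s)"]
    by (simp only: summable_real_powr_iff)
  hence S: "summable (\<lambda>n. G * real (Suc n) powr (- Re s))" by (rule summable_mult)
  have B: "norm (dirichlet_term g s n) \<le> G * real (Suc n) powr (- Re s)" for n
  proof -
    have "norm (complex_of_nat (Suc n) powr (- s)) = real (Suc n) powr (- Re s)"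
      by (subst norm_powr_real_powr) auto
    thus ?thesis unfolding dirichlet_term_def norm_mult using G[of "Suc n"]
      by (intro mult_mono) (auto intro: order_trans[OF norm_ge_zero])
  qed
  show ?thesis
    by (rule summable_comparison_test'[OF S, of 0]) (simp only: real_norm_def abs_norm_cancel B)
qed

text \<open>The residues are represented by 1, ..., m rather than 0, ..., m - 1, which matches the
  start of the series at n = 1 and keeps the Hurwitz parameter positive.\<close>

definition dirichlet_ext :: "nat \<Rightarrow> (int \<Rightarrow> complex) \<Rightarrow> complex \<Rightarrow> complex" where
  "dirichlet_ext m g s = (\<Sum>i<m. g (int (Suc i)) * of_nat m powr (- s) * hurwitz_ext (real (Suc i) / real m) s)"

lemma dirichlet_ext_eq:
  assumes m: "m > 0" and g: "\<And>n. g (n + int m) = g n" and s: "Re s > 1"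
  shows "dirichlet_ext m g s = (\<Sum>n. dirichlet_term g s n)"
proof -
  have "(\<lambda>l. \<Sum>i<m. dirichlet_term g s (l * m + i)) sums (\<Sum>n. dirichlet_term g s n)"
    using summable_norm_cancel[OF summable_dirichlet_term[of m g, OF m g s]] m
    by (intro sums_blocks summable_sums)
  moreover have "(\<lambda>l. \<Sum>i<m. dirichlet_term g s (l * m + i)) sums dirichlet_ext m g s"
    unfolding dirichlet_ext_def
  proof (rule sums_sum)
    fix i assume "i \<in> {..<m}"
    have "(\<lambda>l. g (int (Suc i)) * of_nat m powr (- s) * of_real (real l + real (Suc i) / real m) powr (- s))
            sums (g (int (Suc i)) * of_nat m powr (- s) * hurwitz_ext (real (Suc i) / real m) s)"
      using m s by (intro sums_mult hurwitz_ext_sums) auto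
    moreover have "g (int (Suc i)) * of_nat m powr (- s) * of_real (real l + real (Suc i) / real m) powr (- s)
                     = dirichlet_term g s (l * m + i)" for l
    proof -
      have "complex_of_nat (Suc (l * m + i)) = of_nat m * of_real (real l + real (Suc i) / real m)"
        using m by (simp add: field_simps)
      hence "complex_of_nat (Suc (l * m + i)) powr (- s) =
              of_nat m powr (- s) * of_real (real l + real (Suc i) / real m) powr (- s)"
        by (simp only:) (rule powr_times_real, auto)
      thus ?thesis using periodic_nat_shift[of g m l "Suc i"] g by (simp add: dirichlet_term_def)
    qed
    ultimately show "(\<lambda>l. dirichlet_term g s (l * m + i)) sums
       (g (int (Suc i)) * of_nat m powr (- s) * hurwitz_ext (real (Suc i) / real m) s)" by simp
  qed
  ultimately show ?thesis by (rule sums_unique2[symmetric])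
qed

lemma dirichlet_ext_meromorphic:
  assumes "m > 0"
  shows "dirichlet_ext m g meromorphic_on UNIV"
proof -
  have "(\<lambda>s. complex_of_nat m powr (- s)) meromorphic_on UNIV"
    using assms(1) by (intro analytic_on_imp_meromorphic_on analytic_intros) auto
  thus ?thesis unfolding dirichlet_ext_def[abs_def]
    using assms by (auto intro!: meromorphic_intros hurwitz_ext_meromorphic)
qed

text \<open>The identity theorem is applied to \<open>remove_sings D\<close>, because the difference
  of two nicely meromorphic functions need not be nicely meromorphic: at a common pole both values
  are 0, while the difference may have a nonzero limit. Agreement off isolated points then fixes the
  values, as limits or as 0 at poles.\<close>

lemma nicely_meromorphic_unique:
  assumes F: "F nicely_meromorphic_on UNIV" and G: "G nicely_meromorphic_on UNIV"
    and eq: "\<And>s. Re s > c \<Longrightarrow> F s = G s"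
  shows "F = G"
proof
  fix z :: complex
  define D where "D = (\<lambda>s. F s - G s)"
  have D: "D meromorphic_on UNIV"
    using F G unfolding D_def by (auto simp: nicely_meromorphic_on_def intro!: meromorphic_intros)
  define x where "x = complex_of_real (c + 1)"
  have "open {s. Re s > c}" by (rule open_halfspace_Re_gt)
  hence "\<forall>\<^sub>F s in at x. s \<in> {s. Re s > c}"
    by (intro eventually_at_in_open') (auto simp: x_def)
  hence "\<forall>\<^sub>F s in at x. D s = 0" by eventually_elim (auto simp: D_def eq)
  moreover have "\<forall>\<^sub>F s in at x. remove_sings D s = D s"
    using D by (intro eventually_remove_sings_eq_at) (auto simp: meromorphic_on_altdef)
  ultimately have "\<forall>\<^sub>F s in at x. remove_sings D s = 0" by eventually_elim simp
  hence "\<exists>\<^sub>F s in at x. remove_sings D s = 0" by (simp add: eventually_frequently)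
  hence zero: "remove_sings D s = 0" for s
    using remove_sings_nicely_meromorphic[OF D]
    by (rule frequently_eq_meromorphic_imp_constant) auto
  have "\<forall>\<^sub>F s in at z. remove_sings D s = D s"
    using D by (intro eventually_remove_sings_eq_at) (auto simp: meromorphic_on_altdef)
  hence ev: "\<forall>\<^sub>F s in at z. F s = G s"
  proof eventually_elim
    case (elim s)
    thus ?case using zero[of s] by (simp add: D_def)
  qed
  hence pole: "is_pole F z \<longleftrightarrow> is_pole G z" by (intro is_pole_cong) auto
  show "F z = G z"
  proof (cases "is_pole F z")
    case True
    \<comment> \<open>A nicely meromorphic function takes at each point its limit or the value 0,
      and at a pole there is no finite limit.\<close>
    have pole_value: "H z = 0" if "H nicely_meromorphic_on UNIV" "is_pole H z" for H
      using that not_tendsto_and_filterlim_at_infinity[OF at_neq_bot, of H "H z" z]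
      unfolding nicely_meromorphic_on_def is_pole_def by auto
    show ?thesis using pole_value[OF F True] pole_value[OF G] True pole by simp
  next
    case False
    hence "F \<midarrow>z\<rightarrow> F z" "G \<midarrow>z\<rightarrow> G z"
      using F G pole unfolding nicely_meromorphic_on_def by auto
    moreover have "F \<midarrow>z\<rightarrow> G z"
      using \<open>G \<midarrow>z\<rightarrow> G z\<close> ev by (subst tendsto_cong[OF ev])
    ultimately show ?thesis by (intro tendsto_unique[OF at_neq_bot])
  qed
qed

lemma meromorphic_continuation_eqI:
  assumes "F nicely_meromorphic_on UNIV" "\<And>s. Re s > 1 \<Longrightarrow> F s = f s"
  shows "meromorphic_continuation f = F"
  unfolding meromorphic_continuation_def
  using assms by (intro the_equality nicely_meromorphic_unique[of _ F 1]) auto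

text \<open>\<open>dirichlet_ext\<close> takes wrong values at removable points such as 0, and
  \<open>remove_sings\<close> replaces them by limits. Continuity of the Hurwitz functions on Re s >
  1 shows that nothing is changed there, so the result still extends the series.\<close>

lemma dirichlet_continuation_0:
  assumes m: "m > 0" and g: "\<And>n. g (n + int m) = g n"
  shows "meromorphic_continuation (\<lambda>z. \<Sum>n. dirichlet_term g z n) 0 =
           (\<Sum>i<m. g (int (Suc i)) * (1 / 2 - of_nat (Suc i) / of_nat m))"
proof -
  have cont: "meromorphic_continuation (\<lambda>z. \<Sum>n. dirichlet_term g z n) = remove_sings (dirichlet_ext m g)"
  proof (rule meromorphic_continuation_eqI)
    show "remove_sings (dirichlet_ext m g) nicely_meromorphic_on UNIV"
      by (intro remove_sings_nicely_meromorphic dirichlet_ext_meromorphic m)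
  next
    fix s :: complex assume s: "Re s > 1"
    have op: "open {s. Re s > 1}" by (rule open_halfspace_Re_gt)
    have "hurwitz_ext a \<midarrow>s\<rightarrow> hurwitz_ext a s" if a: "a > 0" for a
    proof -
      have "(\<lambda>z. \<Sum>n. wint a (\<lambda>x. of_real (1 - x)) n (z + 1)) holomorphic_on {s. Re s > 1}"
        by (rule holomorphic_on_compose_gen[OF _ wint_series_holomorphic[OF a continuous_on_one_minus], unfolded o_def])
           (auto intro!: holomorphic_intros)
      hence "(\<lambda>s. of_real a powr (1 - s) / (s - 1) + s * wint_cont a 0 (\<lambda>x. of_real (1 - x)) (s + 1))
              holomorphic_on {s. Re s > 1}"
        using a by (auto intro!: holomorphic_intros simp del: of_real_diff)
      hence "isCont (\<lambda>s. of_real a powr (1 - s) / (s - 1) + s * wint_cont a 0 (\<lambda>x. of_real (1 - x)) (s + 1)) s"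
        using s op by (intro continuous_on_interior[OF holomorphic_on_imp_continuous_on]) (auto simp: interior_open)
      moreover have "\<forall>\<^sub>F s in nhds s. s \<in> {s. Re s > 1}"
        using op s by (intro eventually_nhds_in_open) auto
      hence "\<forall>\<^sub>F s in nhds s. hurwitz_ext a s =
         of_real a powr (1 - s) / (s - 1) + s * wint_cont a 0 (\<lambda>x. of_real (1 - x)) (s + 1)"
        by eventually_elim
           (simp add: hurwitz_ext_def wint_ext_eq[OF a continuous_on_one_minus, of 0] del: of_real_diff)
      hence "isCont (hurwitz_ext a) s \<longleftrightarrow>
         isCont (\<lambda>s. of_real a powr (1 - s) / (s - 1) + s * wint_cont a 0 (\<lambda>x. of_real (1 - x)) (s + 1)) s"
        by (rule isCont_cong)
      ultimately show ?thesis by (simp only: isCont_def)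
    qed
    hence "dirichlet_ext m g \<midarrow>s\<rightarrow> dirichlet_ext m g s"
      unfolding dirichlet_ext_def[abs_def] using m by (intro tendsto_intros) auto
    hence "remove_sings (dirichlet_ext m g) s = dirichlet_ext m g s"
      by (rule remove_sings_eqI)
    thus "remove_sings (dirichlet_ext m g) s = (\<Sum>n. dirichlet_term g s n)"
      using dirichlet_ext_eq[of m g, OF m g s] by simp
  qed
  have "dirichlet_ext m g \<midarrow>0\<rightarrow> (\<Sum>i<m. g (int (Suc i)) * of_nat m powr (- 0) * (1 / 2 - of_real (real (Suc i) / real m)))"
    unfolding dirichlet_ext_def[abs_def] using m by (intro tendsto_intros hurwitz_ext_tendsto_0) auto
  hence "remove_sings (dirichlet_ext m g) 0 = (\<Sum>i<m. g (int (Suc i)) * (1 / 2 - of_nat (Suc i) / of_nat m))"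
    using m by (intro remove_sings_eqI) simp
  thus ?thesis by (simp only: cont)
qed

text \<open>The weight 1/2 - n/m is odd under n -> m - n and \<open>g\<close> is even, so the terms
  n = 1, ..., m - 1 cancel in total. Only n = m is left, with weight -1/2.\<close>

lemma even_periodic_first_moment:
  fixes g :: "int \<Rightarrow> complex"
  assumes m: "m > 0" and g: "\<And>n. g (n + int m) = g n" and even: "\<And>n. g (- n) = g n"
  shows "(\<Sum>i<m. g (int (Suc i)) * (1 / 2 - of_nat (Suc i) / of_nat m)) = - g 0 / 2"
proof -
  obtain k where k: "m = Suc k" using m by (cases m) auto
  define S where "S = (\<Sum>i<k. g (int (Suc i)) * (1 / 2 - of_nat (Suc i) / of_nat m))"
  have reflect: "X * (1 / 2 - (M - c) / M) = - (X * (1 / 2 - c / M))" if "M \<noteq> 0" for X M c :: complex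
    using that by (simp add: field_simps)
  have "S = (\<Sum>i<k. g (int (Suc (k - Suc i))) * (1 / 2 - of_nat (Suc (k - Suc i)) / of_nat m))"
    unfolding S_def by (rule sum.nat_diff_reindex[symmetric])
  also have "\<dots> = (\<Sum>i<k. - (g (int (Suc i)) * (1 / 2 - of_nat (Suc i) / of_nat m)))"
  proof (intro sum.cong refl)
    fix i assume "i \<in> {..<k}"
    hence i: "int (Suc (k - Suc i)) = - int (Suc i) + int m" "Suc (k - Suc i) = m - Suc i" "Suc i \<le> m"
      by (auto simp: k)
    have "g (int (Suc (k - Suc i))) = g (int (Suc i))"
      unfolding i(1) g by (rule even)
    moreover have "(of_nat (Suc (k - Suc i)) :: complex) = of_nat m - of_nat (Suc i)"
      unfolding i(2) using i(3) by (rule of_nat_diff)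
    ultimately show "g (int (Suc (k - Suc i))) * (1 / 2 - of_nat (Suc (k - Suc i)) / of_nat m) =
         - (g (int (Suc i)) * (1 / 2 - of_nat (Suc i) / of_nat m))"
      using reflect[of "of_nat m"] m by (simp del: of_nat_Suc)
  qed
  also have "\<dots> = - S" by (simp add: S_def sum_negf)
  finally have "S = 0" by simp
  moreover have "g (int m) = g 0" using g[of 0] by simp
  moreover have "(\<Sum>i<m. g (int (Suc i)) * (1 / 2 - of_nat (Suc i) / of_nat m)) =
      S + g (int m) * (1 / 2 - of_nat m / of_nat m)"
    by (simp only: S_def k sum.lessThan_Suc)
  ultimately show ?thesis using m by simp
qed

lemma dirichlet_L_0:
  assumes m: "m > 0" and g: "\<And>n. g (n + int m) = g n" and even: "\<And>n. g (- n) = g n"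
  shows "dirichlet_L 0 g = - g 0 / 2"
proof (cases "summable (dirichlet_term g 0)")
  case True
  \<comment> \<open>The series converges at $0$ only if $g$ tends to $0$, hence vanishes by periodicity.\<close>
  have "dirichlet_term g 0 = (\<lambda>n. g (int (Suc n)))" by (auto simp: dirichlet_term_def simp del: of_nat_Suc)
  with True have lim: "(\<lambda>n. g (int (Suc n))) \<longlonglongrightarrow> 0" by (metis summable_LIMSEQ_zero)
  have zero: "g (int i) = 0" for i
  proof -
    \<comment> \<open>The shift \<open>k + 1\<close> keeps the index positive, so that
      \<open>i = 0\<close> is covered although the series starts at n = 1.\<close>
    have "strict_mono (\<lambda>k. (k + 1) * m + i - 1)" using m by (intro strict_monoI_Suc) auto
    from LIMSEQ_subseq_LIMSEQ[OF lim this]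
    have "(\<lambda>k. g (int (Suc ((k + 1) * m + i - 1)))) \<longlonglongrightarrow> 0" unfolding o_def .
    moreover have "Suc ((k + 1) * m + i - 1) = (k + 1) * m + i" for k using m by simp
    ultimately have "(\<lambda>k. g (int ((k + 1) * m + i))) \<longlonglongrightarrow> 0" by (simp only:)
    thus ?thesis unfolding periodic_nat_shift[of g m, OF g] by (simp only: LIMSEQ_const_iff)
  qed
  have "dirichlet_term g 0 = (\<lambda>_. 0)" using zero[of "Suc _"] by (auto simp: dirichlet_term_def)
  thus ?thesis using zero[of 0] by (simp add: dirichlet_L_def)
next
  case False
  thus ?thesis
    using dirichlet_continuation_0[of m g, OF m g] even_periodic_first_moment[of m g, OF m g even]
    by (simp only: dirichlet_L_def if_False)
qed

lemma riemann_zeta_0: "riemann_zeta 0 = - 1 / 2"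
  unfolding riemann_zeta_def by (subst dirichlet_L_0[of 1]) auto

section \<open>Partial fractions of the cotangent\<close>

text \<open>Logarithmic derivative of Euler's reflection formula. With the sine moved to the left
  the product is locally constant, and its derivative can be compared with 0.\<close>

lemma Digamma_reflection:
  assumes "(z :: complex) \<notin> \<int>"
  shows "Digamma (1 - z) - Digamma z = of_real pi * cot (of_real pi * z)"
proof -
  have z: "z \<notin> \<int>\<^sub>\<le>\<^sub>0" "1 - z \<notin> \<int>\<^sub>\<le>\<^sub>0"
    using assms nonpos_Ints_Int[of z] nonpos_Ints_Int[of "1 - z"] Ints_diff[of 1 "1 - z"] by auto
  have sin: "sin (of_real pi * w) \<noteq> 0" if "w \<notin> \<int>" for w :: complex
    using that by (auto simp: sin_eq_0 elim!: Ints_cases)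
  have "open (- \<int> :: complex set)" by (intro open_Compl closed_Ints)
  hence "\<forall>\<^sub>F w in nhds z. w \<in> - \<int>" using assms by (intro eventually_nhds_in_open) auto
  hence "\<forall>\<^sub>F w in nhds z. Gamma w * Gamma (1 - w) * sin (of_real pi * w) = of_real pi"
    by eventually_elim (use sin in \<open>auto simp: Gamma_reflection_complex\<close>)
  hence "((\<lambda>w. Gamma w * Gamma (1 - w) * sin (of_real pi * w)) has_field_derivative 0) (at z)"
    by (subst DERIV_cong_ev[where g = "\<lambda>_. of_real pi"]) auto
  moreover have "((\<lambda>w. Gamma w * Gamma (1 - w) * sin (of_real pi * w)) has_field_derivative
      (Gamma z * Digamma z * Gamma (1 - z) - Gamma z * (Gamma (1 - z) * Digamma (1 - z))) * sin (of_real pi * z)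
      + Gamma z * Gamma (1 - z) * (of_real pi * cos (of_real pi * z))) (at z)"
    using z by (auto intro!: derivative_eq_intros)
  ultimately have "0 = (Gamma z * Digamma z * Gamma (1 - z) - Gamma z * (Gamma (1 - z) * Digamma (1 - z))) * sin (of_real pi * z)
      + Gamma z * Gamma (1 - z) * (of_real pi * cos (of_real pi * z))"
    by (rule DERIV_unique)
  also have "\<dots> = Gamma z * Gamma (1 - z) *
      ((Digamma z - Digamma (1 - z)) * sin (of_real pi * z) + of_real pi * cos (of_real pi * z))"
    by (simp add: algebra_simps)
  finally have "(Digamma z - Digamma (1 - z)) * sin (of_real pi * z) + of_real pi * cos (of_real pi * z) = 0"
    using z by (simp add: Gamma_eq_zero_iff)
  thus ?thesis using sin[OF assms] by (simp add: cot_def field_simps)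
qed

text \<open>Difference of the Digamma series at 1 - z and at z, in which the Euler constants and the
  terms 1/(n + 1) cancel. The one-sided pairing of n + z with n + 1 - z later becomes the pairing of
  a residue class with its negative.\<close>

lemma cot_sums:
  assumes "(z :: complex) \<notin> \<int>"
  shows "(\<lambda>n. 1 / (of_nat n + z) - 1 / (of_nat n + 1 - z)) sums (of_real pi * cot (of_real pi * z))"
proof -
  have z: "z \<noteq> 0" "1 - z \<noteq> 0" using assms by auto
  have *: "(\<lambda>k. inverse (of_nat (Suc k)) - inverse (w + of_nat k)) sums (Digamma w + euler_mascheroni)"
    if "w \<noteq> 0" for w :: complex
    using summable_sums[OF summable_Digamma[OF that]] by (simp add: Digamma_def)
  from sums_diff[OF *[OF z(2)] *[OF z(1)]] show ?thesis
    unfolding Digamma_reflection[OF assms, symmetric] by (simp add: field_simps)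
qed

lemma cot_exp:
  assumes "exp (2 * \<i> * z) \<noteq> 1"
  shows "cot z = \<i> * (1 + 2 / (exp (2 * \<i> * z) - 1))"
proof -
  define E where "E = exp (\<i> * z)"
  have E: "E \<noteq> 0" by (simp add: E_def)
  define D where "D = E * E - 1"
  have exp: "exp (2 * \<i> * z) = E * E" by (simp add: E_def exp_add[symmetric] algebra_simps)
  have D: "D \<noteq> 0" using assms by (simp add: exp D_def)
  have "sin z = (E - 1 / E) / (2 * \<i>)" "cos z = (E + 1 / E) / 2"
    by (simp_all add: sin_exp_eq cos_exp_eq E_def exp_minus inverse_eq_divide)
  moreover have "E - 1 / E = D / E" "E + 1 / E = (D + 2) / E"
    using E by (simp_all add: D_def field_simps)
  ultimately have "cot z = ((D + 2) / E / 2) / (D / E / (2 * \<i>))"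
    by (simp only: cot_def)
  also have "\<dots> = \<i> * (1 + 2 / D)"
    using E D by (simp add: field_simps)
  finally show ?thesis by (simp only: exp D_def)
qed

text \<open>Serves two purposes: the denominators of the twisted series do not vanish, and they grow
  at least linearly, uniformly over all roots of unity.\<close>

lemma exp_mult_minus_one_ge:
  fixes u :: complex
  assumes "x > 0" "norm u = 1"
  shows "norm (exp (complex_of_real x) * u - 1) \<ge> x"
proof -
  have "1 + x \<le> exp x" by (rule exp_ge_add_one_self)
  also have "\<dots> = norm (exp (complex_of_real x) * u)" using assms by (simp add: norm_mult)
  finally show ?thesis using norm_triangle_ineq2[of "exp (complex_of_real x) * u" 1] by simp
qed

text \<open>The cotangent expansion scaled by 1/m: the first fractions run over the residue class of
  r, the second ones over that of -r.\<close>

lemma residue_sums: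
  assumes m: "m > 0" and omega: "\<omega> = exp (2 * of_real pi * \<i> / of_nat m)" and c: "c > 0"
  shows "(\<lambda>l. 1 / (of_nat (l * m + r) - \<i> * of_real c) - 1 / (of_nat (Suc l * m) - of_nat r + \<i> * of_real c)) sums
           (\<i> * of_real pi / of_nat m * (1 + 2 / (exp (of_real (2 * pi * c / m)) * \<omega> ^ r - 1)))"
proof -
  \<comment> \<open>The sign of \<open>c\<close> makes exp(2 pi i z) equal to e^(2 pi c/m) times
    \<omega>^r, of modulus greater than 1, as in the denominators of the theorem. A nonzero
    imaginary part keeps \<open>z\<close> away from the integers.\<close>
  define z where "z = (of_nat r - \<i> * of_real c) / of_nat m"
  have "Im z \<noteq> 0" using c m by (simp add: z_def Im_divide_of_nat)
  hence z: "z \<notin> \<int>" by (auto elim!: Ints_cases)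
  have "exp (2 * \<i> * (of_real pi * z)) = exp (of_real (2 * pi * c / m)) * \<omega> ^ r"
    using m unfolding omega exp_of_nat_mult[symmetric] exp_add[symmetric] z_def
    by (intro arg_cong[of _ _ exp]) (simp add: field_simps)
  moreover have "exp (of_real (2 * pi * c / m)) * \<omega> ^ r \<noteq> 1"
  proof -
    have "2 * pi * c / m > 0" "norm (\<omega> ^ r) = 1" using c m by (simp_all add: norm_power omega)
    from exp_mult_minus_one_ge[OF this] this(1) show ?thesis by auto
  qed
  ultimately have cot: "cot (of_real pi * z) = \<i> * (1 + 2 / (exp (of_real (2 * pi * c / m)) * \<omega> ^ r - 1))"
    using cot_exp[of "of_real pi * z"] by simp
  have "(\<lambda>l. (1 / (of_nat l + z) - 1 / (of_nat l + 1 - z)) / of_nat m) sums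
          (of_real pi * cot (of_real pi * z) / of_nat m)"
    by (intro sums_divide cot_sums z)
  moreover have "(1 / (of_nat l + z) - 1 / (of_nat l + 1 - z)) / of_nat m =
     1 / (of_nat (l * m + r) - \<i> * of_real c) - 1 / (of_nat (Suc l * m) - of_nat r + \<i> * of_real c)" for l
  proof -
    have "of_nat (l * m + r) - \<i> * of_real c = (of_nat l + z) * of_nat m"
      "of_nat (Suc l * m) - of_nat r + \<i> * of_real c = (of_nat l + 1 - z) * of_nat m"
      using m by (simp_all add: z_def field_simps)
    thus ?thesis by (simp only: diff_divide_distrib divide_divide_eq_left)
  qed
  moreover have "of_real pi * cot (of_real pi * z) / of_nat m =
      \<i> * of_real pi / of_nat m * (1 + 2 / (exp (of_real (2 * pi * c / m)) * \<omega> ^ r - 1))"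
    unfolding cot by simp
  ultimately show ?thesis by (simp only:)
qed

section \<open>Cotangent sums weighted by a periodic function\<close>

locale periodic_function =
  fixes m :: nat and g :: "int \<Rightarrow> complex"
  assumes m: "m > 0" and periodic: "\<And>n. g (n + int m) = g n"
begin

lemma periodic_m: "g (int m) = g 0"
  using periodic[of 0] by simp

text \<open>The reflection r -> m - r carries 0, ..., m - 1 to 1, ..., m. The sign \<sigma> lets one
  lemma serve both parities.\<close>

lemma residue_reflect:
  assumes sym: "\<And>n. g (- n) = \<sigma> * g n"
  shows "(\<Sum>r<m. g (int r) * f (m - r)) = \<sigma> * (\<Sum>i<m. g (int (Suc i)) * f (Suc i))"
proof -
  have "(\<Sum>r<m. g (int r) * f (m - r)) = (\<Sum>i<m. g (int (m - Suc i)) * f (m - (m - Suc i)))"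
    by (rule sum.nat_diff_reindex[symmetric])
  also have "\<dots> = (\<Sum>i<m. \<sigma> * (g (int (Suc i)) * f (Suc i)))"
  proof (intro sum.cong refl)
    fix i assume "i \<in> {..<m}"
    hence i: "int (m - Suc i) = - int (Suc i) + int m" "m - (m - Suc i) = Suc i" by auto
    show "g (int (m - Suc i)) * f (m - (m - Suc i)) = \<sigma> * (g (int (Suc i)) * f (Suc i))"
      unfolding i periodic sym by (rule mult.assoc)
  qed
  finally show ?thesis by (simp only: sum_distrib_left)
qed

lemma odd_periodic_mean:
  assumes odd: "\<And>n. g (- n) = - g n"
  shows "periodic_mean m g = 0"
proof -
  have "(\<Sum>r<m. g (int r)) = - (\<Sum>i<m. g (int (Suc i)))"
    using residue_reflect[of "- 1" "\<lambda>_. 1"] odd by simp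
  moreover have "(\<Sum>i<m. g (int (Suc i))) = (\<Sum>i<m. g (int i))"
    using sum.lessThan_Suc_shift[of "\<lambda>i. g (int i)" m] periodic_m by simp
  ultimately show ?thesis by (simp add: periodic_mean_def)
qed

end

locale periodic_function_root = periodic_function m g for m g +
  fixes \<omega> :: complex
  assumes omega: "\<omega> = exp (2 * of_real pi * \<i> / of_nat m)"
begin

text \<open>Weighting \<open>residue_sums\<close> by \<open>g\<close> and reflecting the second
  fractions gives almost the claim, except that the first fractions are taken over residues 0, ...,
  m - 1 and a block has 1, ..., m. The discrepancy telescopes to g(0)/(-ic) = i g(0)/c, which is the
  last term.\<close>

lemma periodic_block_sums:
  assumes c: "c > 0" and sym: "\<And>n. g (- n) = \<sigma> * g n"
  shows "(\<lambda>l. \<Sum>i<m. g (int (Suc i)) *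
            (1 / (of_nat (l * m + Suc i) - \<i> * of_real c) - \<sigma> / (of_nat (l * m + Suc i) + \<i> * of_real c))) sums
          (\<i> * of_real pi * (periodic_mean m g + 2 / of_nat m *
            (\<Sum>r<m. g (int r) / (exp (of_real (2 * pi * c / m)) * \<omega> ^ r - 1))) - \<i> * g 0 / of_real c)"
    (is "?L sums ?R")
proof -
  let ?d = "\<lambda>n. 1 / (of_nat n - \<i> * of_real c) :: complex"
  let ?e = "\<lambda>n. 1 / (of_nat n + \<i> * of_real c) :: complex"
  let ?E = "\<lambda>r. exp (of_real (2 * pi * c / m)) * \<omega> ^ r - 1"
  have "filterlim (\<lambda>l. l * m) at_top sequentially"
    using m by (intro filterlim_subseq strict_monoI) auto
  hence "filterlim (\<lambda>l. complex_of_nat (l * m)) at_infinity sequentially"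
    by (rule filterlim_compose[OF tendsto_of_nat])
  hence "filterlim (\<lambda>l. - (\<i> * of_real c) + complex_of_nat (l * m)) at_infinity sequentially"
    by (rule tendsto_add_filterlim_at_infinity[OF tendsto_const])
  hence "filterlim (\<lambda>l. complex_of_nat (l * m) - \<i> * of_real c) at_infinity sequentially"
    by (simp only: uminus_add_conv_diff)
  hence "(\<lambda>l. ?d (l * m)) \<longlonglongrightarrow> 0"
    by (rule tendsto_divide_0[OF tendsto_const])
  hence "(\<lambda>l. ?d (l * m) - ?d (Suc l * m)) sums (?d (0 * m) - 0)"
    by (rule telescope_sums')
  hence tele: "(\<lambda>l. g 0 * (?d (l * m) - ?d (Suc l * m))) sums (g 0 * ?d 0)"
    by (intro sums_mult) simp
  have "(\<lambda>l. \<Sum>r<m. g (int r) * (?d (l * m + r) - 1 / (of_nat (Suc l * m) - of_nat r + \<i> * of_real c))) sums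
         (\<Sum>r<m. g (int r) * (\<i> * of_real pi / of_nat m * (1 + 2 / ?E r)))"
    by (intro sums_sum sums_mult residue_sums m omega c)
  from sums_diff[OF this tele]
  have "(\<lambda>l. (\<Sum>r<m. g (int r) * (?d (l * m + r) - 1 / (of_nat (Suc l * m) - of_nat r + \<i> * of_real c)))
            - g 0 * (?d (l * m) - ?d (Suc l * m))) sums
         ((\<Sum>r<m. g (int r) * (\<i> * of_real pi / of_nat m * (1 + 2 / ?E r))) - g 0 * ?d 0)" .
  moreover have "(\<Sum>r<m. g (int r) * (?d (l * m + r) - 1 / (of_nat (Suc l * m) - of_nat r + \<i> * of_real c)))
            - g 0 * (?d (l * m) - ?d (Suc l * m)) = ?L l" for l
  proof -
    have "(\<Sum>r<m. g (int r) * (1 / (of_nat (Suc l * m) - of_nat r + \<i> * of_real c))) =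
          (\<Sum>r<m. g (int r) * ?e (l * m + (m - r)))"
      by (intro sum.cong refl) (simp add: of_nat_diff algebra_simps)
    also have "\<dots> = \<sigma> * (\<Sum>i<m. g (int (Suc i)) * ?e (l * m + Suc i))"
      by (rule residue_reflect[OF sym])
    finally have 1: "(\<Sum>r<m. g (int r) * (1 / (of_nat (Suc l * m) - of_nat r + \<i> * of_real c))) = \<dots>" .
    \<comment> \<open>A sum of m + 1 consecutive terms, once with the first and once with the last
      split off, moves the window of residues by one.\<close>
    have "(\<Sum>r<Suc m. g (int r) * ?d (l * m + r)) = g 0 * ?d (l * m) + (\<Sum>i<m. g (int (Suc i)) * ?d (l * m + Suc i))"
      by (subst sum.lessThan_Suc_shift) simp
    moreover have "(\<Sum>r<Suc m. g (int r) * ?d (l * m + r)) = (\<Sum>r<m. g (int r) * ?d (l * m + r)) + g 0 * ?d (Suc l * m)"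
      by (simp add: periodic_m add.commute)
    ultimately have 2: "(\<Sum>r<m. g (int r) * ?d (l * m + r)) - g 0 * (?d (l * m) - ?d (Suc l * m)) =
        (\<Sum>i<m. g (int (Suc i)) * ?d (l * m + Suc i))"
      by (simp only: right_diff_distrib)
         (metis (no_types, lifting) add_diff_cancel_left' add_diff_eq diff_diff_eq2)
    have "?L l = (\<Sum>i<m. g (int (Suc i)) * ?d (l * m + Suc i)) - \<sigma> * (\<Sum>i<m. g (int (Suc i)) * ?e (l * m + Suc i))"
      unfolding sum_distrib_left sum_subtractf[symmetric]
      by (intro sum.cong refl) (simp add: right_diff_distrib)
    thus ?thesis
      unfolding 2[symmetric] 1[symmetric]
      by (simp only: right_diff_distrib sum_subtractf) simp
  qed
  moreover have "(\<Sum>r<m. g (int r) * (\<i> * of_real pi / of_nat m * (1 + 2 / ?E r))) - g 0 * ?d 0 = ?R"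
  proof -
    have "(\<Sum>r<m. g (int r) * (\<i> * of_real pi / of_nat m * (1 + 2 / ?E r))) =
        \<i> * of_real pi / of_nat m * ((\<Sum>r<m. g (int r)) + 2 * (\<Sum>r<m. g (int r) / ?E r))"
      unfolding sum_distrib_left sum.distrib[symmetric]
      by (intro sum.cong refl) (simp add: distrib_left mult_ac)
    also have "\<dots> = \<i> * of_real pi * (periodic_mean m g + 2 / of_nat m * (\<Sum>r<m. g (int r) / ?E r))"
      using m by (simp add: periodic_mean_def field_simps)
    finally show ?thesis using c by (simp add: field_simps)
  qed
  ultimately show ?thesis by simp
qed

text \<open>For \<open>\<sigma> = - 1\<close> the two fractions add up to 2n/(n^2 + c^2). The
  boundary term disappears with g(0) and the constant with the mean.\<close>

lemma odd_block_sums: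
  assumes c: "c > 0" and odd: "\<And>n. g (- n) = - g n" and mean: "periodic_mean m g = 0"
  shows "(\<lambda>l. \<Sum>i<m. g (int (Suc i)) * (of_nat (l * m + Suc i) / of_real (real (l * m + Suc i) ^ 2 + c\<^sup>2))) sums
          (\<i> * of_real pi / of_nat m *
            (\<Sum>r<m. g (int r) / (exp (of_real (2 * pi * c / m)) * \<omega> ^ r - 1)))"
proof -
  have g0: "g 0 = 0" using odd[of 0] by simp
  have eq: "(1 / (of_nat n - \<i> * of_real c) - (- 1) / (of_nat n + \<i> * of_real c)) / 2 = of_nat n / of_real (real n ^ 2 + c\<^sup>2)" for n
  proof -
    have "(of_nat n - \<i> * of_real c) * (of_nat n + \<i> * of_real c) = of_real (real n ^ 2 + c\<^sup>2)"
      by (simp add: algebra_simps power2_eq_square)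
    moreover have "of_nat n - \<i> * of_real c \<noteq> 0" "of_nat n + \<i> * of_real c \<noteq> 0"
      using c by (auto simp: complex_eq_iff)
    ultimately show ?thesis by (simp add: field_simps del: of_real_add of_real_power)
  qed
  have "(\<Sum>i<m. g (int (Suc i)) * (1 / (of_nat (l * m + Suc i) - \<i> * of_real c) -
            (- 1) / (of_nat (l * m + Suc i) + \<i> * of_real c))) / 2 =
        (\<Sum>i<m. g (int (Suc i)) * (of_nat (l * m + Suc i) / of_real (real (l * m + Suc i) ^ 2 + c\<^sup>2)))" for l
    by (simp only: sum_divide_distrib times_divide_eq_right[symmetric] eq)
  moreover have "(\<i> * of_real pi * (0 + 2 / of_nat m * Q) - \<i> * 0 / of_real c) / 2 =
      \<i> * of_real pi / of_nat m * Q" for Q :: complex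
    by simp
  ultimately show ?thesis
    using sums_divide[OF periodic_block_sums[OF c, of "- 1"], of 2] odd
    by (simp only: g0 mean mult_minus1 simp_thms)
qed

text \<open>For \<open>\<sigma> = 1\<close> the two fractions subtract to 2ic/(n^2 + c^2), whence
  the division by 2ic. The boundary term survives as half of the missing term n = 0.\<close>

lemma even_block_sums:
  assumes c: "c > 0" and even: "\<And>n. g (- n) = g n"
  shows "(\<lambda>l. \<Sum>i<m. g (int (Suc i)) * (1 / of_real (real (l * m + Suc i) ^ 2 + c\<^sup>2))) sums
          (of_real (pi / c) * (periodic_mean m g / 2 + 1 / of_nat m *
            (\<Sum>r<m. g (int r) / (exp (of_real (2 * pi * c / m)) * \<omega> ^ r - 1))) - g 0 / of_real (2 * c\<^sup>2))"
proof -
  have eq: "(1 / (of_nat n - \<i> * of_real c) - 1 / (of_nat n + \<i> * of_real c)) / (2 * \<i> * of_real c) = 1 / of_real (real n ^ 2 + c\<^sup>2)" for n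
  proof -
    have "(of_nat n - \<i> * of_real c) * (of_nat n + \<i> * of_real c) = of_real (real n ^ 2 + c\<^sup>2)"
      by (simp add: algebra_simps power2_eq_square)
    moreover have "of_nat n - \<i> * of_real c \<noteq> 0" "of_nat n + \<i> * of_real c \<noteq> 0"
      using c by (auto simp: complex_eq_iff)
    ultimately show ?thesis using c by (simp add: field_simps del: of_real_add of_real_power)
  qed
  define Q where "Q = (\<Sum>r<m. g (int r) / (exp (of_real (2 * pi * c / m)) * \<omega> ^ r - 1))"
  have "(\<i> * of_real pi * (periodic_mean m g + 2 / of_nat m * Q) - \<i> * g 0 / of_real c) / (2 * \<i> * of_real c) =
     of_real (pi / c) * (periodic_mean m g / 2 + 1 / of_nat m * Q) - g 0 / of_real (2 * c\<^sup>2)"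
    using c m by (simp add: field_simps power2_eq_square)
  moreover have "(\<Sum>i<m. g (int (Suc i)) * (1 / (of_nat (l * m + Suc i) - \<i> * of_real c) -
            1 / (of_nat (l * m + Suc i) + \<i> * of_real c))) / (2 * \<i> * of_real c) =
        (\<Sum>i<m. g (int (Suc i)) * (1 / of_real (real (l * m + Suc i) ^ 2 + c\<^sup>2)))" for l
    by (simp only: sum_divide_distrib times_divide_eq_right[symmetric] eq)
  ultimately show ?thesis
    using sums_divide[OF periodic_block_sums[OF c, of 1], of "2 * \<i> * of_real c"] even
    unfolding Q_def[symmetric] by (simp only: mult_1_left simp_thms)
qed

end

text \<open>The case m = 1, g = 1 of the column evaluation, so rows and columns rest on the same
  expansion. The bracket 1/2 + 1/(e^(2 pi c) - 1) is half of coth(pi c).\<close>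

lemma coth_sums:
  assumes c: "c > 0"
  shows "(\<lambda>k. 1 / (real (Suc k) ^ 2 + c\<^sup>2)) sums
           (pi / c * (1 / 2 + 1 / (exp (2 * pi * c) - 1)) - 1 / (2 * c\<^sup>2))"
proof -
  interpret periodic_function_root 1 "\<lambda>_. 1" 1 by unfold_locales auto
  have "(\<lambda>k. complex_of_real (1 / (real (Suc k) ^ 2 + c\<^sup>2))) sums
           of_real (pi / c * (1 / 2 + 1 / (exp (2 * pi * c) - 1)) - 1 / (2 * c\<^sup>2))"
    using even_block_sums[OF c] by (simp add: periodic_mean_def exp_of_real[symmetric])
  thus ?thesis by (simp only: sums_of_real_iff)
qed

section \<open>Double series\<close>

text \<open>A product majorant makes the family absolutely summable over pairs. In the application
  \<open>l\<close> numbers blocks of m consecutive n, so only block sums have to be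
  dominated.\<close>

lemma double_series_swap:
  fixes F :: "nat \<Rightarrow> nat \<Rightarrow> complex"
  assumes F: "\<And>l k. norm (F l k) \<le> a l * b k" and a: "summable a" and b: "summable b"
    and nonneg: "\<And>l. a l \<ge> 0" "\<And>k. b k \<ge> 0"
  shows "(\<lambda>k. \<Sum>l. F l k) sums (\<Sum>l. \<Sum>k. F l k)"
proof -
  have "(\<lambda>(l, k). a l * b k) summable_on UNIV \<times> UNIV"
  proof (rule summable_on_SigmaI)
    show "((\<lambda>k. (case (l, k) of (l, k) \<Rightarrow> a l * b k)) has_sum a l * suminf b) UNIV" for l
      using b nonneg by (auto intro!: sums_nonneg_imp_has_sum sums_mult summable_sums)
    show "(\<lambda>l. a l * suminf b) summable_on UNIV"
      using a nonneg suminf_nonneg[OF b nonneg(2)]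
      by (subst summable_on_UNIV_nonneg_real_iff) (auto intro!: summable_mult2)
  qed (use nonneg in auto)
  hence "(\<lambda>x. norm ((\<lambda>(l, k). F l k) x)) summable_on UNIV \<times> UNIV"
    by (rule Infinite_Sum.abs_summable_on_comparison_test') (use F in auto)
  hence on: "(\<lambda>(l, k). F l k) summable_on UNIV \<times> UNIV"
    by (rule abs_summable_summable)
  have norm_row: "summable (\<lambda>k. norm (F l k))" for l
    by (rule summable_comparison_test[OF _ summable_mult[OF b, of "a l"]]) (use F in auto)
  have norm_col: "summable (\<lambda>l. norm (F l k))" for k
    by (rule summable_comparison_test[OF _ summable_mult2[OF a, of "b k"]]) (use F in auto)
  have inf_suminf: "infsum f UNIV = suminf f" if "summable (\<lambda>n. norm (f n))" for f :: "nat \<Rightarrow> complex"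
    using norm_summable_imp_has_sum[OF that summable_sums[OF summable_norm_cancel[OF that]]]
    by (rule infsumI)
  have row: "(\<lambda>l. \<Sum>k. F l k) summable_on UNIV"
    using summable_on_Sigma_banach[OF on] by (simp add: inf_suminf norm_row)
  have on': "(\<lambda>(k, l). F l k) summable_on UNIV \<times> UNIV"
    using on by (subst summable_on_swap) (simp add: case_prod_unfold)
  have col: "(\<lambda>k. \<Sum>l. F l k) summable_on UNIV"
    using summable_on_Sigma_banach[OF on'] by (simp add: inf_suminf norm_col)
  have "infsum (\<lambda>l. \<Sum>k. F l k) UNIV = infsum (\<lambda>k. \<Sum>l. F l k) UNIV"
    using infsum_swap_banach[OF on] by (simp add: inf_suminf norm_row norm_col)
  moreover have "infsum (\<lambda>l. \<Sum>k. F l k) UNIV = (\<Sum>l. \<Sum>k. F l k)"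
    using has_sum_imp_sums[OF has_sum_infsum[OF row]] by (simp add: sums_iff)
  ultimately show ?thesis
    using has_sum_imp_sums[OF has_sum_infsum[OF col]] by simp
qed

section \<open>Dirichlet series at positive integers\<close>

lemma summable_Suc_power:
  assumes "p \<ge> 2"
  shows "summable (\<lambda>n. 1 / real (Suc n) ^ p)"
  using inverse_power_summable[OF assms, where 'a = real] summable_Suc_iff[of "\<lambda>n. inverse (real n ^ p)"]
  by (simp only: inverse_eq_divide)

lemma dirichlet_term_of_nat:
  "dirichlet_term g (of_nat p) n = g (int (Suc n)) / of_nat (Suc n) ^ p"
  unfolding dirichlet_term_def powr_minus by (subst powr_nat') (auto simp: divide_inverse simp del: of_nat_Suc)

context periodic_function
begin

lemma summable_norm_dirichlet_power:
  assumes "p \<ge> 2"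
  shows "summable (\<lambda>n. norm (g (int (Suc n)) / of_nat (Suc n) ^ p))"
  using summable_dirichlet_term[of m g, OF m periodic, of "of_nat p"] assms
  unfolding dirichlet_term_of_nat by simp

text \<open>Moving the window by one replaces g(n) by the equal value g(n + m), so a block may start
  anywhere.\<close>

lemma mean_zero_window:
  assumes "periodic_mean m g = 0"
  shows "(\<Sum>i<m. g (int (n + i))) = 0"
proof (induction n)
  case 0
  show ?case using assms m by (simp add: periodic_mean_def)
next
  case (Suc n)
  have "(\<Sum>i<m. g (int (n + i))) + g (int n + int m) = (\<Sum>i<Suc m. g (int (n + i)))" by simp
  also have "\<dots> = g (int n) + (\<Sum>i<m. g (int (Suc n + i)))"
    by (subst sum.lessThan_Suc_shift) simp
  finally show ?case using Suc.IH by (simp only: periodic) simp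
qed

text \<open>Dirichlet's test: with mean zero the partial sums of \<open>g\<close> are themselves
  periodic, hence bounded.\<close>

lemma summable_dirichlet_one:
  assumes mean: "periodic_mean m g = 0"
  shows "summable (\<lambda>n. g (int (Suc n)) / of_nat (Suc n))"
proof -
  define G where "G n = (\<Sum>i<n. g (int (Suc i)))" for n
  define C where "C = (\<Sum>n<m. norm (G n))"
  have split: "(\<Sum>i<N + k. f i) = (\<Sum>i<N. f i) + (\<Sum>i<k. f (N + i))" for N k and f :: "nat \<Rightarrow> complex"
    by (induction k) (simp_all add: add_ac)
  have shift: "G (k * m + n) = G n" for k n
  proof (induction k)
    case (Suc k)
    have "G (Suc k * m + n) = (\<Sum>i<k * m + n + m. g (int (Suc i)))"
      by (simp add: G_def add_ac)
    also have "\<dots> = G (k * m + n) + (\<Sum>i<m. g (int (Suc (k * m + n) + i)))"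
      unfolding G_def split by simp
    finally show ?case using Suc mean_zero_window[OF mean, of "Suc (k * m + n)"] by simp
  qed auto
  have bound: "norm (G n) \<le> C" for n
  proof -
    have "norm (G n) = norm (G (n mod m))" using shift[of "n div m" "n mod m"] by simp
    also have "\<dots> \<le> C" unfolding C_def using m by (intro member_le_sum) auto
    finally show ?thesis .
  qed
  \<comment> \<open>Abel summation: the terms are the increments of \<open>u\<close> plus an absolutely summable series.\<close>
  define u where "u n = G n / of_nat (Suc n)" for n
  have "u \<longlonglongrightarrow> 0"
  proof (rule Lim_null_comparison)
    show "\<forall>\<^sub>F n in sequentially. norm (u n) \<le> C * inverse (real (Suc n))"
    proof (intro always_eventually allI)
      fix n
      have "norm (u n) = norm (G n) * inverse (real (Suc n))"
        unfolding u_def norm_divide norm_of_nat by (rule divide_inverse)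
      also have "\<dots> \<le> C * inverse (real (Suc n))"
        by (intro mult_right_mono bound) auto
      finally show "norm (u n) \<le> C * inverse (real (Suc n))" .
    qed
    show "(\<lambda>n. C * inverse (real (Suc n))) \<longlonglongrightarrow> 0"
      using tendsto_mult[OF tendsto_const LIMSEQ_inverse_real_of_nat, of C] by simp
  qed
  hence "summable (\<lambda>n. u (Suc n) - u n)" by (intro telescope_summable)
  moreover have "summable (\<lambda>n. G (Suc n) / (of_nat (Suc n) * of_nat (Suc (Suc n))))"
  proof (rule summable_comparison_test[OF _ summable_mult[OF summable_Suc_power[of 2], of C]])
    have "norm (G (Suc n) / (of_nat (Suc n) * of_nat (Suc (Suc n)))) \<le> C * (1 / real (Suc n) ^ 2)" for n
    proof -
      have "norm (G (Suc n) / (of_nat (Suc n) * of_nat (Suc (Suc n)))) =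
              norm (G (Suc n)) * (1 / (real (Suc n) * real (Suc (Suc n))))"
        by (simp add: norm_divide norm_mult del: of_nat_Suc)
      also have "\<dots> \<le> C * (1 / (real (Suc n) * real (Suc n)))"
        using bound[of "Suc n"] by (intro mult_mono divide_left_mono) (auto intro: order_trans[OF norm_ge_zero])
      finally show ?thesis by (simp add: power2_eq_square)
    qed
    thus "\<exists>N. \<forall>n\<ge>N. norm (G (Suc n) / (of_nat (Suc n) * of_nat (Suc (Suc n)))) \<le> C * (1 / real (Suc n) ^ 2)"
      by blast
  qed simp
  ultimately have "summable (\<lambda>n. (u (Suc n) - u n) + G (Suc n) / (of_nat (Suc n) * of_nat (Suc (Suc n))))"
    by (rule summable_add)
  also have "(\<lambda>n. (u (Suc n) - u n) + G (Suc n) / (of_nat (Suc n) * of_nat (Suc (Suc n)))) =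
       (\<lambda>n. g (int (Suc n)) / of_nat (Suc n))"
  proof
    fix n
    have G: "G (Suc n) = G n + g (int (Suc n))" by (simp add: G_def)
    have abel: "(H + x) / (N + 1) - H / N + (H + x) / (N * (N + 1)) = x / N"
      if "N \<noteq> 0" "N + 1 \<noteq> 0" for H x N :: complex
    proof -
      have "1 / (N + 1) + 1 / (N * (N + 1)) = 1 / N"
        using that by (simp add: divide_simps)
      moreover have "(H + x) / (N + 1) - H / N + (H + x) / (N * (N + 1)) =
          (H + x) * (1 / (N + 1) + 1 / (N * (N + 1))) - H / N"
        by (simp add: distrib_left)
      ultimately show ?thesis by (simp add: distrib_right add_divide_distrib)
    qed
    have "complex_of_nat (Suc (Suc n)) = of_nat (Suc n) + 1" by simp
    moreover have "complex_of_nat (Suc n) + 1 \<noteq> 0"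
      using of_nat_neq_0[of "Suc n", where 'a = complex] by simp
    ultimately show "(u (Suc n) - u n) + G (Suc n) / (of_nat (Suc n) * of_nat (Suc (Suc n))) = g (int (Suc n)) / of_nat (Suc n)"
      unfolding u_def G using abel[of "of_nat (Suc n)" "G n" "g (int (Suc n))"] of_nat_neq_0[of n, where 'a = complex]
      by (simp only: simp_thms)
  qed
  finally show ?thesis .
qed

lemma dirichlet_L_of_nat_sums:
  assumes "p \<ge> 2 \<or> p = 1 \<and> periodic_mean m g = 0"
  shows "(\<lambda>n. g (int (Suc n)) / of_nat (Suc n) ^ p) sums dirichlet_L (of_nat p) g"
proof -
  have "summable (\<lambda>n. g (int (Suc n)) / of_nat (Suc n) ^ p)"
    using assms
  proof
    assume "p \<ge> 2"
    thus ?thesis by (intro summable_norm_cancel[OF summable_norm_dirichlet_power])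
  qed (use summable_dirichlet_one in simp)
  moreover have "dirichlet_term g (of_nat p) = (\<lambda>n. g (int (Suc n)) / of_nat (Suc n) ^ p)"
    by (rule ext) (rule dirichlet_term_of_nat)
  ultimately show ?thesis unfolding dirichlet_L_def by (simp add: summable_sums)
qed

end

lemma riemann_zeta_of_nat_sums:
  assumes "p \<ge> 2"
  shows "(\<lambda>n. 1 / of_nat (Suc n) ^ p) sums riemann_zeta (of_nat p)"
proof -
  interpret periodic_function 1 "\<lambda>_. 1" by unfold_locales auto
  show ?thesis using dirichlet_L_of_nat_sums[of p] assms by (simp add: riemann_zeta_def)
qed

section \<open>Rows: the sum over k for fixed n\<close>

lemma coth_expansion:
  assumes "\<alpha> > 0" "\<beta> > 0" "\<alpha> * \<beta> = pi\<^sup>2" "x > 0"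
  shows "(\<lambda>k. x / (\<alpha> * x\<^sup>2 + \<beta> * real (Suc k) ^ 2)) sums
           (1 / 2 + 1 / (exp (2 * x * \<alpha>) - 1) - 1 / (2 * x * \<alpha>))"
proof -
  \<comment> \<open>This makes 2 pi c equal to 2 x \<alpha>, while
    \<open>\<alpha> * \<beta> = pi\<^sup>2\<close> gives c^2 = \<alpha> x^2/\<beta>, so that k^2 +
    c^2 is the kernel denominator divided by \<beta>.\<close>
  define c where "c = x * \<alpha> / pi"
  have c: "c > 0" using assms by (simp add: c_def)
  have "c\<^sup>2 = (x * \<alpha>)\<^sup>2 / (\<alpha> * \<beta>)" by (simp only: c_def power_divide assms(3))
  hence c2: "c\<^sup>2 = \<alpha> * x\<^sup>2 / \<beta>"
    using assms(1,2) by (simp add: power2_eq_square)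
  have pic: "pi / c = \<beta> / x"
  proof -
    have "pi / c = (\<alpha> * \<beta>) / (x * \<alpha>)" by (simp add: c_def assms(3) power2_eq_square)
    thus ?thesis using assms(1) by simp
  qed
  have "(\<lambda>k. x / \<beta> * (1 / (real (Suc k) ^ 2 + c\<^sup>2))) sums
           (x / \<beta> * (pi / c * (1 / 2 + 1 / (exp (2 * pi * c) - 1)) - 1 / (2 * c\<^sup>2)))"
    by (intro sums_mult coth_sums c)
  moreover have "x / \<beta> * (1 / (real (Suc k) ^ 2 + c\<^sup>2)) = x / (\<alpha> * x\<^sup>2 + \<beta> * real (Suc k) ^ 2)" for k
    using assms(2) unfolding c2 by (simp add: distrib_left add.commute del: of_nat_Suc)
  moreover have "x / \<beta> * (pi / c * (1 / 2 + 1 / (exp (2 * pi * c) - 1)) - 1 / (2 * c\<^sup>2)) =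
      1 / 2 + 1 / (exp (2 * x * \<alpha>) - 1) - 1 / (2 * x * \<alpha>)"
  proof -
    have "2 * pi * c = 2 * x * \<alpha>" by (simp add: c_def)
    moreover have "x / \<beta> * (\<beta> / x * y - 1 / (2 * (\<alpha> * x\<^sup>2 / \<beta>))) = y - 1 / (2 * x * \<alpha>)" for y
      using assms by (simp add: field_simps power2_eq_square)
    ultimately show ?thesis unfolding pic c2 by (simp only:)
  qed
  ultimately show ?thesis by (simp only:)
qed

text \<open>Each step trades a factor 1/x^2 for -(\<alpha>/\<beta>)/y^2 and leaves behind one term
  free of the denominator; the j-th term comes from the j-th step. The coefficient
  \<alpha>^(j-1)/\<beta>^j is written as a quotient so that the same expression gives 1/\<alpha> at
  j = 0.\<close>

lemma geometric_expansion:
  fixes x y \<alpha> \<beta> :: "'a :: field"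
  assumes nz: "x \<noteq> 0" "y \<noteq> 0" "\<alpha> \<noteq> 0" "\<beta> \<noteq> 0" "\<alpha> * x\<^sup>2 + \<beta> * y\<^sup>2 \<noteq> 0"
  shows "1 / (\<alpha> * x\<^sup>2 + \<beta> * y\<^sup>2) / x ^ (2 * q) =
     (\<Sum>j=1..q. (-1) ^ (j + 1) * (\<alpha> ^ j / (\<alpha> * \<beta> ^ j)) * (1 / y ^ (2 * j)) / x ^ (2 * (q - j) + 2))
     + (- \<alpha> / \<beta>) ^ q * (1 / (\<alpha> * x\<^sup>2 + \<beta> * y\<^sup>2) / y ^ (2 * q))"
proof (induction q)
  case (Suc q)
  define D where "D = \<alpha> * x\<^sup>2 + \<beta> * y\<^sup>2"
  have D: "D \<noteq> 0" using nz by (simp add: D_def)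
  have step: "1 / D / x\<^sup>2 = 1 / (\<beta> * y\<^sup>2 * x\<^sup>2) - \<alpha> / \<beta> * (1 / D / y\<^sup>2)"
  proof -
    have "1 / (\<beta> * y\<^sup>2 * x\<^sup>2) - \<alpha> / \<beta> * (1 / D / y\<^sup>2) = (D - \<alpha> * x\<^sup>2) / (D * (\<beta> * y\<^sup>2) * x\<^sup>2)"
      using nz(1-4) D by (simp add: field_simps)
    also have "D - \<alpha> * x\<^sup>2 = \<beta> * y\<^sup>2" by (simp add: D_def)
    finally show ?thesis using nz(1-4) by simp
  qed
  have "1 / D / x ^ (2 * Suc q) = 1 / D / x ^ (2 * q) / x\<^sup>2"
    by (simp add: power_add mult_ac power2_eq_square)
  also have "\<dots> = (\<Sum>j=1..q. (-1) ^ (j + 1) * (\<alpha> ^ j / (\<alpha> * \<beta> ^ j)) * (1 / y ^ (2 * j)) / x ^ (2 * (q - j) + 2)) / x\<^sup>2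
     + (- \<alpha> / \<beta>) ^ q / y ^ (2 * q) * (1 / D / x\<^sup>2)"
    unfolding Suc.IH[folded D_def] by (simp add: add_divide_distrib)
  also have "(\<Sum>j=1..q. (-1) ^ (j + 1) * (\<alpha> ^ j / (\<alpha> * \<beta> ^ j)) * (1 / y ^ (2 * j)) / x ^ (2 * (q - j) + 2)) / x\<^sup>2 =
     (\<Sum>j=1..q. (-1) ^ (j + 1) * (\<alpha> ^ j / (\<alpha> * \<beta> ^ j)) * (1 / y ^ (2 * j)) / x ^ (2 * (Suc q - j) + 2))"
    unfolding sum_divide_distrib divide_divide_eq_left
    by (intro sum.cong refl arg_cong2[of _ _ _ _ "(/)"] arg_cong2[of _ _ _ _ "(*)"])
       (simp add: Suc_diff_le power_add power2_eq_square mult_ac)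
  also have "(- \<alpha> / \<beta>) ^ q / y ^ (2 * q) * (1 / D / x\<^sup>2) =
     (-1) ^ (Suc q + 1) * \<alpha> ^ Suc q / (\<alpha> * \<beta> ^ Suc q) * (1 / y ^ (2 * Suc q)) / x ^ (2 * (Suc q - Suc q) + 2)
     + (- \<alpha> / \<beta>) ^ Suc q * (1 / D / y ^ (2 * Suc q))"
  proof -
    have R: "(- \<alpha> / \<beta>) ^ q = (-1) ^ q * \<alpha> ^ q / \<beta> ^ q"
      by (simp only: power_divide power_minus[of \<alpha>])
    have y: "y ^ (2 * Suc q) = y ^ (2 * q) * y\<^sup>2" by (simp add: power_add power2_eq_square)
    have "(-1) ^ (Suc q + 1) * \<alpha> ^ Suc q / (\<alpha> * \<beta> ^ Suc q) * (1 / y ^ (2 * Suc q)) / x ^ (2 * (Suc q - Suc q) + 2)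
            = (- \<alpha> / \<beta>) ^ q / y ^ (2 * q) * (1 / (\<beta> * y\<^sup>2 * x\<^sup>2))"
      unfolding R y using nz(3) by (simp add: power2_eq_square)
    moreover have "(- \<alpha> / \<beta>) ^ Suc q * (1 / D / y ^ (2 * Suc q)) =
            - ((- \<alpha> / \<beta>) ^ q / y ^ (2 * q) * (\<alpha> / \<beta> * (1 / D / y\<^sup>2)))"
      unfolding y by (simp add: mult_ac)
    ultimately show ?thesis unfolding step right_diff_distrib by simp
  qed
  finally show ?case
    unfolding D_def[symmetric] by (simp only: sum.cl_ivl_Suc) (simp add: add.assoc)
qed auto

definition lattice_kernel :: "real \<Rightarrow> real \<Rightarrow> nat \<Rightarrow> nat \<Rightarrow> complex" where
  "lattice_kernel \<alpha> \<beta> n k = 1 / of_real (\<alpha> * real n ^ 2 + \<beta> * real k ^ 2)"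

text \<open>Half of coth(n \<alpha>). It joins the two parts of the left-hand brace, the half
  L-value and the exponential series, in a single sum.\<close>

definition bernoulli_factor :: "real \<Rightarrow> nat \<Rightarrow> complex" where
  "bernoulli_factor \<alpha> n = 1 / 2 + 1 / (exp (2 * of_nat n * of_real \<alpha>) - 1)"

text \<open>
  As $\zeta(0) = -\frac12$, the case $j = 0$ is the term $1/(2\alpha)$ of the hyperbolic cotangent.
\<close>
definition zeta_coeff :: "real \<Rightarrow> real \<Rightarrow> nat \<Rightarrow> complex" where
  "zeta_coeff \<alpha> \<beta> j = (-1) ^ (j + 1) * of_real (\<alpha> ^ j / (\<alpha> * \<beta> ^ j)) * riemann_zeta (of_nat (2 * j))"

locale conjugate_pair =
  fixes \<alpha> \<beta> :: real
  assumes alpha: "\<alpha> > 0" and beta: "\<beta> > 0" and alpha_beta: "\<alpha> * \<beta> = pi\<^sup>2"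
begin

text \<open>Prepares the columns: here k plays the role of the parameter, with c = \<beta> k/pi in
  the cotangent sums over n.\<close>

lemma kernel_scaled:
  "lattice_kernel \<alpha> \<beta> n k = 1 / of_real \<alpha> * (1 / of_real (real n ^ 2 + (\<beta> * real k / pi)\<^sup>2))"
proof -
  have "(\<beta> * real k / pi)\<^sup>2 = (\<beta> * real k)\<^sup>2 / (\<alpha> * \<beta>)" by (simp only: power_divide alpha_beta)
  also have "\<alpha> * \<dots> = \<beta> * real k ^ 2"
    using alpha beta by (simp add: power2_eq_square)
  finally have "\<alpha> * real n ^ 2 + \<beta> * real k ^ 2 = \<alpha> * (real n ^ 2 + (\<beta> * real k / pi)\<^sup>2)"
    by (simp add: distrib_left)
  thus ?thesis unfolding lattice_kernel_def by (simp only:) simp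
qed

text \<open>Sum the geometric expansion over k: the left side is the hyperbolic cotangent, the
  finite part gives the values \<zeta>(2j), and the identity is solved for the remainder.\<close>

lemma kernel_row_sums:
  fixes n q :: nat
  assumes n: "n > 0"
  shows "(\<lambda>k. lattice_kernel \<alpha> \<beta> n (Suc k) / of_nat (Suc k) ^ (2 * q)) sums
     ((bernoulli_factor \<alpha> n / of_nat n ^ (2 * q + 1) -
        (\<Sum>j=0..q. zeta_coeff \<alpha> \<beta> j / of_nat n ^ (2 * (q - j) + 2))) / of_real (- \<alpha> / \<beta>) ^ q)"
proof -
  define R where "R = complex_of_real (- \<alpha> / \<beta>) ^ q"
  have R: "R \<noteq> 0" using alpha beta by (simp add: R_def)
  define A where "A k = (\<Sum>j=1..q. (-1) ^ (j + 1) * of_real (\<alpha> ^ j / (\<alpha> * \<beta> ^ j)) * (1 / of_nat (Suc k) ^ (2 * j))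
              / of_nat n ^ (2 * (q - j) + 2) :: complex)" for k
  have geo: "lattice_kernel \<alpha> \<beta> n (Suc k) / of_nat n ^ (2 * q) =
      A k + R * (lattice_kernel \<alpha> \<beta> n (Suc k) / of_nat (Suc k) ^ (2 * q))" for k
  proof -
    have "\<alpha> * (real n)\<^sup>2 + \<beta> * (real (Suc k))\<^sup>2 \<noteq> 0"
      using alpha beta n by (intro less_imp_neq[symmetric] add_pos_pos mult_pos_pos) auto
    hence "complex_of_real (\<alpha> * (real n)\<^sup>2 + \<beta> * (real (Suc k))\<^sup>2) \<noteq> 0"
      unfolding of_real_eq_0_iff .
    hence nz: "complex_of_real \<alpha> * of_nat n ^ 2 + of_real \<beta> * of_nat (Suc k) ^ 2 \<noteq> 0"
      unfolding of_real_add of_real_mult of_real_power of_real_of_nat_eq .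
    have "complex_of_nat n \<noteq> 0" "complex_of_nat (Suc k) \<noteq> 0" "complex_of_real \<alpha> \<noteq> 0" "complex_of_real \<beta> \<noteq> 0"
      using n alpha beta by (auto simp del: of_nat_Suc)
    from geometric_expansion[OF this nz, of q] show ?thesis
      unfolding lattice_kernel_def A_def R_def
      by (simp only: of_real_of_nat_eq of_real_power of_real_mult of_real_add of_real_divide of_real_minus)
  qed
  have "(\<lambda>k. complex_of_real (real n / (\<alpha> * (real n)\<^sup>2 + \<beta> * real (Suc k) ^ 2))) sums
           of_real (1 / 2 + 1 / (exp (2 * real n * \<alpha>) - 1) - 1 / (2 * real n * \<alpha>))"
    using n by (intro sums_of_real coth_expansion alpha beta alpha_beta) auto
  hence "(\<lambda>k. of_nat n * lattice_kernel \<alpha> \<beta> n (Suc k)) sums (bernoulli_factor \<alpha> n - 1 / (2 * of_nat n * of_real \<alpha>))"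
    by (simp add: lattice_kernel_def bernoulli_factor_def exp_of_real[symmetric] del: of_nat_Suc)
  hence "(\<lambda>k. of_nat n * lattice_kernel \<alpha> \<beta> n (Suc k) / of_nat n ^ (2 * q + 1)) sums
     ((bernoulli_factor \<alpha> n - 1 / (2 * of_nat n * of_real \<alpha>)) / of_nat n ^ (2 * q + 1))"
    by (rule sums_divide)
  hence lhs: "(\<lambda>k. lattice_kernel \<alpha> \<beta> n (Suc k) / of_nat n ^ (2 * q)) sums
     ((bernoulli_factor \<alpha> n - 1 / (2 * of_nat n * of_real \<alpha>)) / of_nat n ^ (2 * q + 1))"
    using n by simp
  have "A sums (\<Sum>j=1..q. zeta_coeff \<alpha> \<beta> j / of_nat n ^ (2 * (q - j) + 2))"
    unfolding A_def[abs_def] zeta_coeff_def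
    by (intro sums_sum sums_divide sums_mult riemann_zeta_of_nat_sums) auto
  from sums_divide[OF sums_diff[OF lhs this], of R]
  have "(\<lambda>k. lattice_kernel \<alpha> \<beta> n (Suc k) / of_nat (Suc k) ^ (2 * q)) sums
     (((bernoulli_factor \<alpha> n - 1 / (2 * of_nat n * of_real \<alpha>)) / of_nat n ^ (2 * q + 1) -
        (\<Sum>j=1..q. zeta_coeff \<alpha> \<beta> j / of_nat n ^ (2 * (q - j) + 2))) / R)"
    unfolding geo using R by simp
  moreover have "(bernoulli_factor \<alpha> n - 1 / (2 * of_nat n * of_real \<alpha>)) / of_nat n ^ (2 * q + 1) =
      bernoulli_factor \<alpha> n / of_nat n ^ (2 * q + 1) - zeta_coeff \<alpha> \<beta> 0 / of_nat n ^ (2 * (q - 0) + 2)"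
    by (simp add: zeta_coeff_def riemann_zeta_0 diff_divide_distrib mult_ac)
  moreover have "(\<Sum>j=0..q. zeta_coeff \<alpha> \<beta> j / of_nat n ^ (2 * (q - j) + 2)) =
      zeta_coeff \<alpha> \<beta> 0 / of_nat n ^ (2 * (q - 0) + 2) + (\<Sum>j=1..q. zeta_coeff \<alpha> \<beta> j / of_nat n ^ (2 * (q - j) + 2))"
    by (subst sum.atLeast_Suc_atMost) auto
  ultimately show ?thesis by (simp only: R_def diff_diff_eq)
qed

text \<open>Common core of both parities: w(n) is n g(n) for odd \<open>g\<close> and g(n) for even
  \<open>g\<close>. The rows are known from \<open>\<Lambda>\<close> and \<open>S\<close>, the
  columns from \<open>V\<close>. Equating the two iterated sums and solving for \<open>S\<close>
  gives the identity.\<close>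

lemma lattice_sum_swap:
  fixes w :: "nat \<Rightarrow> complex" and m q :: nat
  assumes m: "m > 0"
    and Lam: "\<And>j. j \<le> q \<Longrightarrow> (\<lambda>n. w (Suc n) / of_nat (Suc n) ^ (2 * (q - j) + 2)) sums \<Lambda> j"
    and S: "(\<lambda>n. w (Suc n) * bernoulli_factor \<alpha> (Suc n) / of_nat (Suc n) ^ (2 * q + 1)) sums S"
    and bound: "\<And>l k. norm (\<Sum>i<m. w (l * m + Suc i) * lattice_kernel \<alpha> \<beta> (l * m + Suc i) (Suc k)) / real (Suc k) ^ (2 * q)
                   \<le> a l * b k"
    and ab: "summable a" "summable b" "\<And>l. a l \<ge> 0" "\<And>k. b k \<ge> 0"
    and V: "\<And>k. (\<lambda>l. \<Sum>i<m. w (l * m + Suc i) * lattice_kernel \<alpha> \<beta> (l * m + Suc i) (Suc k)) sums V k"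
  shows "S = (\<Sum>j=0..q. zeta_coeff \<alpha> \<beta> j * \<Lambda> j) + of_real (- \<alpha> / \<beta>) ^ q * (\<Sum>k. V k / of_nat (Suc k) ^ (2 * q))"
proof -
  define R where "R = complex_of_real (- \<alpha> / \<beta>) ^ q"
  have R: "R \<noteq> 0" using alpha beta by (simp add: R_def)
  define Y where "Y n = (bernoulli_factor \<alpha> n / of_nat n ^ (2 * q + 1) -
        (\<Sum>j=0..q. zeta_coeff \<alpha> \<beta> j / of_nat n ^ (2 * (q - j) + 2))) / R" for n
  define F where "F l k = (\<Sum>i<m. w (l * m + Suc i) * lattice_kernel \<alpha> \<beta> (l * m + Suc i) (Suc k))
                      / of_nat (Suc k) ^ (2 * q)" for l k
  have "(\<lambda>n. (w (Suc n) * bernoulli_factor \<alpha> (Suc n) / of_nat (Suc n) ^ (2 * q + 1)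
             - (\<Sum>j=0..q. zeta_coeff \<alpha> \<beta> j * (w (Suc n) / of_nat (Suc n) ^ (2 * (q - j) + 2)))) / R)
         sums ((S - (\<Sum>j=0..q. zeta_coeff \<alpha> \<beta> j * \<Lambda> j)) / R)"
    by (intro sums_divide sums_diff S sums_sum sums_mult Lam) auto
  also have "(\<lambda>n. (w (Suc n) * bernoulli_factor \<alpha> (Suc n) / of_nat (Suc n) ^ (2 * q + 1)
             - (\<Sum>j=0..q. zeta_coeff \<alpha> \<beta> j * (w (Suc n) / of_nat (Suc n) ^ (2 * (q - j) + 2)))) / R) =
      (\<lambda>n. w (Suc n) * Y (Suc n))"
    by (simp only: Y_def right_diff_distrib diff_divide_distrib sum_distrib_left times_divide_eq_right mult.commute mult.left_commute)
  finally have "(\<lambda>l. \<Sum>i<m. w (Suc (l * m + i)) * Y (Suc (l * m + i))) sums ((S - (\<Sum>j=0..q. zeta_coeff \<alpha> \<beta> j * \<Lambda> j)) / R)"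
    using m by (rule sums_blocks)
  moreover have "F l sums (\<Sum>i<m. w (Suc (l * m + i)) * Y (Suc (l * m + i)))" for l
  proof -
    have "(\<lambda>k. \<Sum>i<m. w (Suc (l * m + i)) * (lattice_kernel \<alpha> \<beta> (Suc (l * m + i)) (Suc k) / of_nat (Suc k) ^ (2 * q)))
       sums (\<Sum>i<m. w (Suc (l * m + i)) * Y (Suc (l * m + i)))"
      unfolding Y_def R_def by (intro sums_sum sums_mult kernel_row_sums) auto
    thus ?thesis unfolding F_def[abs_def] by (simp add: sum_divide_distrib del: of_nat_Suc)
  qed
  hence "(\<Sum>i<m. w (Suc (l * m + i)) * Y (Suc (l * m + i))) = (\<Sum>k. F l k)" for l
    by (simp add: sums_iff)
  ultimately have tot: "(\<lambda>l. \<Sum>k. F l k) sums ((S - (\<Sum>j=0..q. zeta_coeff \<alpha> \<beta> j * \<Lambda> j)) / R)" by (simp only:)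
  have swap: "(\<lambda>k. \<Sum>l. F l k) sums (\<Sum>l. \<Sum>k. F l k)"
  proof (rule double_series_swap[OF _ ab])
    show "norm (F l k) \<le> a l * b k" for l k
      using bound[of l k] unfolding F_def norm_divide norm_power norm_of_nat .
  qed
  have col: "(\<Sum>l. F l k) = V k / of_nat (Suc k) ^ (2 * q)" for k
    using sums_divide[OF V[of k], of "of_nat (Suc k) ^ (2 * q)"] unfolding F_def by (rule sums_unique[symmetric])
  from swap have "(\<lambda>k. V k / of_nat (Suc k) ^ (2 * q)) sums ((S - (\<Sum>j=0..q. zeta_coeff \<alpha> \<beta> j * \<Lambda> j)) / R)"
    unfolding col sums_unique[OF tot, symmetric] .
  hence "(\<Sum>k. V k / of_nat (Suc k) ^ (2 * q)) = (S - (\<Sum>j=0..q. zeta_coeff \<alpha> \<beta> j * \<Lambda> j)) / R"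
    by (rule sums_unique[symmetric])
  thus "S = (\<Sum>j=0..q. zeta_coeff \<alpha> \<beta> j * \<Lambda> j) + of_real (- \<alpha> / \<beta>) ^ q * (\<Sum>k. V k / of_nat (Suc k) ^ (2 * q))"
    using R unfolding R_def[symmetric] by simp
qed

end

section \<open>Majorants for the block sums\<close>

lemma periodic_block_norm_le:
  fixes g :: "int \<Rightarrow> complex"
  assumes "\<And>n. norm (g (int n)) \<le> G" "\<And>i. i < m \<Longrightarrow> norm (h i) \<le> M"
  shows "norm (\<Sum>i<m. g (int (l * m + Suc i)) * h i) \<le> real m * G * M"
proof -
  have "norm (\<Sum>i<m. g (int (l * m + Suc i)) * h i) \<le> of_nat (card {..<m}) * (G * M)"
  proof (rule sum_norm_bound)
    fix i assume "i \<in> {..<m}"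
    thus "norm (g (int (l * m + Suc i)) * h i) \<le> G * M"
      unfolding norm_mult using assms(2) order_trans[OF norm_ge_zero assms(1)]
      by (intro mult_mono assms(1)) auto
  qed
  thus ?thesis by simp
qed

text \<open>Subtracting the value of \<open>f\<close> at the last index of the block does not change
  the sum, so the block is controlled by the variation of \<open>f\<close> across it.\<close>

lemma (in periodic_function) mean_zero_block_norm_le:
  fixes f :: "nat \<Rightarrow> complex"
  assumes mean: "periodic_mean m g = 0"
    and G: "\<And>n. norm (g (int n)) \<le> G"
    and f: "\<And>n. l * m < n \<Longrightarrow> n \<le> l * m + m \<Longrightarrow> norm (f n - f (l * m + m)) \<le> M"
  shows "norm (\<Sum>i<m. g (int (l * m + Suc i)) * f (l * m + Suc i)) \<le> real m * G * M"
proof -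
  have "(\<Sum>i<m. g (int (l * m + Suc i))) = 0"
    using mean_zero_window[OF mean, of "l * m + 1"] by simp
  hence "(\<Sum>i<m. g (int (l * m + Suc i)) * f (l * m + Suc i)) =
      (\<Sum>i<m. g (int (l * m + Suc i)) * (f (l * m + Suc i) - f (l * m + m)))"
    by (simp only: right_diff_distrib sum_subtractf sum_distrib_right[symmetric]) simp
  also have "norm \<dots> \<le> real m * G * M"
    by (intro periodic_block_norm_le G f) auto
  finally show ?thesis .
qed

text \<open>The numerator of the difference, \<alpha> a b - \<beta> y^2, is dominated by the
  denominator at b, which cancels. The bound is uniform in y; decay in y will come from k^(-2q) with
  q > 0.\<close>

lemma odd_kernel_diff:
  fixes \<alpha> \<beta> a b y :: real
  assumes "\<alpha> > 0" "\<beta> > 0" "0 < a" "a \<le> b" "y > 0"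
  shows "\<bar>a / (\<alpha> * a\<^sup>2 + \<beta> * y\<^sup>2) - b / (\<alpha> * b\<^sup>2 + \<beta> * y\<^sup>2)\<bar> \<le> (b - a) / (\<alpha> * a\<^sup>2)"
proof -
  define K where "K = \<beta> * y\<^sup>2"
  have K: "K > 0" using assms by (simp add: K_def)
  have D: "\<alpha> * a\<^sup>2 + K > 0" "\<alpha> * b\<^sup>2 + K > 0"
    using assms K by (auto intro!: add_pos_pos)
  have "a / (\<alpha> * a\<^sup>2 + K) - b / (\<alpha> * b\<^sup>2 + K) =
      (b - a) * (\<alpha> * a * b - K) / ((\<alpha> * a\<^sup>2 + K) * (\<alpha> * b\<^sup>2 + K))"
    using D by (simp add: divide_simps) (simp add: algebra_simps power2_eq_square)
  also have "\<bar>\<dots>\<bar> = (b - a) * \<bar>\<alpha> * a * b - K\<bar> / ((\<alpha> * a\<^sup>2 + K) * (\<alpha> * b\<^sup>2 + K))"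
    using D assms by (simp add: abs_mult)
  also have "\<dots> \<le> (b - a) * (\<alpha> * b\<^sup>2 + K) / ((\<alpha> * a\<^sup>2 + K) * (\<alpha> * b\<^sup>2 + K))"
  proof (intro divide_right_mono mult_left_mono)
    have "0 \<le> \<alpha> * a * b" "\<alpha> * a * b \<le> \<alpha> * b * b"
      using assms by (auto intro!: mult_right_mono)
    thus "\<bar>\<alpha> * a * b - K\<bar> \<le> \<alpha> * b\<^sup>2 + K" using K by (simp add: power2_eq_square)
  qed (use assms D in auto)
  also have "\<dots> = (b - a) / (\<alpha> * a\<^sup>2 + K)" using D by simp
  also have "\<dots> \<le> (b - a) / (\<alpha> * a\<^sup>2)"
    using assms K by (intro divide_left_mono) (auto intro!: mult_pos_pos add_pos_pos)
  finally show ?thesis by (simp only: K_def)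
qed

text \<open>Intended for q = 0, where the kernel itself must decay summably in both variables.
  Writing D(x) for the denominator at x, the arithmetic-geometric mean inequality gives D(x) >= 2 pi
  x y. At b this cancels a + b <= 2b and leaves 1/y; at a it is balanced against D(a) >= \<alpha>
  a^2, so both exponents become 3/2.\<close>

lemma even_kernel_diff:
  fixes \<alpha> \<beta> a b y :: real
  assumes "\<alpha> > 0" "\<beta> > 0" "\<alpha> * \<beta> = pi\<^sup>2" "0 < a" "a \<le> b" "y > 0"
  shows "\<bar>1 / (\<alpha> * a\<^sup>2 + \<beta> * y\<^sup>2) - 1 / (\<alpha> * b\<^sup>2 + \<beta> * y\<^sup>2)\<bar>
           \<le> \<alpha> * (b - a) / (pi * sqrt (2 * pi * \<alpha>)) * (1 / sqrt (a ^ 3) * (1 / sqrt (y ^ 3)))"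
proof -
  define Da where "Da = \<alpha> * a\<^sup>2 + \<beta> * y\<^sup>2"
  define Db where "Db = \<alpha> * b\<^sup>2 + \<beta> * y\<^sup>2"
  have amgm: "2 * pi * x * y \<le> \<alpha> * x\<^sup>2 + \<beta> * y\<^sup>2" for x
  proof -
    have "sqrt \<alpha> * sqrt \<beta> = pi" using assms(3) by (simp add: real_sqrt_mult[symmetric])
    moreover have "0 \<le> (sqrt \<alpha> * x - sqrt \<beta> * y)\<^sup>2" by simp
    hence "2 * (sqrt \<alpha> * sqrt \<beta>) * x * y \<le> (sqrt \<alpha>)\<^sup>2 * x\<^sup>2 + (sqrt \<beta>)\<^sup>2 * y\<^sup>2"
      by (simp add: power2_diff power_mult_distrib mult_ac)
    ultimately show ?thesis using assms(1,2) by simp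
  qed
  have Da: "Da > 0" "2 * pi * a * y \<le> Da" "\<alpha> * a\<^sup>2 \<le> Da"
    using assms amgm by (auto simp: Da_def intro!: add_pos_pos)
  have Db: "Db > 0" "2 * pi * b * y \<le> Db" 
    using assms amgm by (auto simp: Db_def intro!: add_pos_pos)
  \<comment> \<open>The geometric mean of the two lower bounds of \<open>Da\<close> is of order
    a^(3/2) y^(1/2).\<close>
  have "(\<alpha> * a\<^sup>2) * (2 * pi * a * y) \<le> Da * Da"
    using assms Da by (intro mult_mono) auto
  hence "(2 * pi * \<alpha>) * a ^ 3 * y \<le> Da\<^sup>2"
    by (simp add: power2_eq_square power3_eq_cube mult_ac)
  hence "sqrt ((2 * pi * \<alpha>) * a ^ 3 * y) \<le> Da" using Da by (intro real_le_lsqrt) auto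
  hence Da': "sqrt (2 * pi * \<alpha>) * sqrt (a ^ 3) * sqrt y \<le> Da" by (simp only: real_sqrt_mult)
  have sq: "y * sqrt y = sqrt (y ^ 3)" 
    using assms by (simp add: power3_eq_cube real_sqrt_mult)
  have "1 / Da - 1 / Db = (Db - Da) / (Da * Db)"
    using Da Db by (simp add: divide_simps)
  also have "Db - Da = \<alpha> * (b - a) * (a + b)"
    by (simp add: Da_def Db_def algebra_simps power2_eq_square)
  finally have "\<bar>1 / Da - 1 / Db\<bar> = \<alpha> * (b - a) * (a + b) / (Da * Db)"
    using assms Da Db by simp
  also have "\<dots> \<le> \<alpha> * (b - a) * (2 * b) / (Da * (2 * pi * b * y))"
    using assms Da Db by (intro frac_le mult_left_mono mult_nonneg_nonneg mult_pos_pos) auto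
  also have "\<dots> = \<alpha> * (b - a) / (pi * y) * (1 / Da)"
    using assms Da by (simp add: field_simps)
  also have "\<dots> \<le> \<alpha> * (b - a) / (pi * y) * (1 / (sqrt (2 * pi * \<alpha>) * sqrt (a ^ 3) * sqrt y))"
    using assms Da Da' by (intro mult_left_mono divide_left_mono mult_pos_pos divide_nonneg_pos) auto
  also have "\<dots> = \<alpha> * (b - a) / (pi * sqrt (2 * pi * \<alpha>)) * (1 / sqrt (a ^ 3) * (1 / (y * sqrt y)))"
    by simp
  finally show ?thesis by (simp only: sq Da_def Db_def)
qed

lemma summable_sqrt_cube: "summable (\<lambda>n. 1 / sqrt (real (Suc n) ^ 3))"
proof -
  have "summable (\<lambda>n. real (Suc n) powr (- 3 / 2))"
    using summable_Suc_iff[of "\<lambda>n. real n powr (- 3 / 2)"] summable_real_powr_iff[of "- 3 / 2"] by simp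
  moreover have "real (Suc n) powr (- 3 / 2) = 1 / sqrt (real (Suc n) ^ 3)" for n
    by (simp add: powr_half_sqrt[symmetric] powr_realpow[symmetric] powr_powr powr_minus_divide del: of_nat_Suc powr_numeral)
  ultimately show ?thesis by (simp only:)
qed

text \<open>The linear lower bound on the denominator supplies a second factor n, so p = 1, the case
  q = 0 of the even identity, is included.\<close>

lemma summable_exp_denominator:
  fixes w u :: "nat \<Rightarrow> complex"
  assumes "c > 0" "\<And>n. norm (w n) \<le> G" "\<And>n. norm (u n) = 1" "p \<ge> 1"
  shows "summable (\<lambda>n. w n / of_nat (Suc n) ^ p / (exp (of_real (c * real (Suc n))) * u n - 1))"
proof (rule summable_comparison_test'[OF summable_mult[OF summable_Suc_power[of 2], of "G / c"], of 0])
  fix n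
  have "norm (w n / of_nat (Suc n) ^ p / (exp (of_real (c * real (Suc n))) * u n - 1)) =
      norm (w n) / (real (Suc n) ^ p * norm (exp (of_real (c * real (Suc n))) * u n - 1))"
    unfolding norm_divide norm_power norm_of_nat by (rule divide_divide_eq_left)
  also have "\<dots> \<le> G / (real (Suc n) ^ 1 * (c * real (Suc n)))"
    using assms by (intro frac_le mult_mono power_increasing exp_mult_minus_one_ge mult_pos_pos)
      (auto intro: order_trans[OF norm_ge_zero])
  also have "\<dots> = G / c * (1 / real (Suc n) ^ 2)" by (simp add: power2_eq_square)
  finally show "norm (w n / of_nat (Suc n) ^ p / (exp (of_real (c * real (Suc n))) * u n - 1)) \<le> G / c * (1 / real (Suc n) ^ 2)" .
qed simp

section \<open>The two identities\<close>

definition twisted_sum :: "nat \<Rightarrow> (int \<Rightarrow> complex) \<Rightarrow> real \<Rightarrow> complex \<Rightarrow> nat \<Rightarrow> complex" where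
  "twisted_sum m g \<beta> \<omega> n = (\<Sum>r<m. g (int r) / (exp (2 * of_nat n * of_real \<beta> / of_nat m) * \<omega> ^ r - 1))"

definition exp_series :: "(int \<Rightarrow> complex) \<Rightarrow> real \<Rightarrow> nat \<Rightarrow> complex" where
  "exp_series g \<alpha> p = (\<Sum>n. g (int (Suc n)) / of_nat (Suc n) ^ p / (exp (2 * of_nat (Suc n) * of_real \<alpha>) - 1))"

lemma twisted_sum_alt:
  "(\<Sum>r<m. g (int r) / (exp (of_real (2 * pi * (\<beta> * real n / pi) / m)) * \<omega> ^ r - 1)) = twisted_sum m g \<beta> \<omega> n"
  unfolding twisted_sum_def by (simp add: mult_ac)

text \<open>Converts decay in n into decay in the block number.\<close>

lemma block_index_ge:
  assumes "m > 0" "l * m < n"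
  shows "real (Suc l) \<le> real n"
proof -
  have "l \<le> l * m" using assms(1) by simp
  hence "Suc l \<le> n" using assms(2) by linarith
  thus ?thesis by (simp only: of_nat_le_iff)
qed

locale periodic_conjugate = periodic_function m g + conjugate_pair \<alpha> \<beta> for m g \<alpha> \<beta>
begin

lemma bernoulli_series_sums:
  assumes "p \<ge> 2 \<or> p = 1 \<and> periodic_mean m g = 0"
  shows "(\<lambda>n. g (int (Suc n)) * bernoulli_factor \<alpha> (Suc n) / of_nat (Suc n) ^ p) sums
           (1 / 2 * dirichlet_L (of_nat p) g + exp_series g \<alpha> p)"
proof -
  obtain G where G: "\<And>n. norm (g (int n)) \<le> G" using periodic_bounded[of m g, OF m periodic] by blast
  have "summable (\<lambda>n. g (int (Suc n)) / of_nat (Suc n) ^ p / (exp (of_real (2 * \<alpha> * real (Suc n))) * 1 - 1))"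
    using assms alpha by (intro summable_exp_denominator[where G = G] G) auto
  hence "(\<lambda>n. g (int (Suc n)) / of_nat (Suc n) ^ p / (exp (2 * of_nat (Suc n) * of_real \<alpha>) - 1)) sums exp_series g \<alpha> p"
    unfolding exp_series_def by (intro summable_sums) (simp add: mult_ac del: of_nat_Suc)
  moreover have "(\<lambda>n. 1 / 2 * (g (int (Suc n)) / of_nat (Suc n) ^ p)) sums (1 / 2 * dirichlet_L (of_nat p) g)"
    by (intro sums_mult dirichlet_L_of_nat_sums[OF assms])
  ultimately have "(\<lambda>n. 1 / 2 * (g (int (Suc n)) / of_nat (Suc n) ^ p) +
       g (int (Suc n)) / of_nat (Suc n) ^ p / (exp (2 * of_nat (Suc n) * of_real \<alpha>) - 1)) sums
       (1 / 2 * dirichlet_L (of_nat p) g + exp_series g \<alpha> p)" by (intro sums_add)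
  thus ?thesis
    by (simp add: bernoulli_factor_def distrib_left add_divide_distrib mult_ac del: of_nat_Suc)
qed

text \<open>For fixed k the factor n/D(n,k) is only of order 1/n; cancellation inside a block gains
  another factor 1/n, and q > 0 provides summability in k.\<close>

lemma odd_kernel_bound:
  assumes mean: "periodic_mean m g = 0" and G: "\<And>n. norm (g (int n)) \<le> G" and q: "q > 0"
  shows "norm (\<Sum>i<m. (g (int (l * m + Suc i)) * of_nat (l * m + Suc i)) * lattice_kernel \<alpha> \<beta> (l * m + Suc i) (Suc k))
            / real (Suc k) ^ (2 * q) \<le> (real m * G * (real m / \<alpha>)) * (1 / real (Suc l) ^ 2) * (1 / real (Suc k) ^ 2)"
proof -
  define f where "f n = complex_of_nat n * lattice_kernel \<alpha> \<beta> n (Suc k)" for n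
  define M where "M = real m / (\<alpha> * real (Suc l) ^ 2)"
  have f: "f n = of_real (real n / (\<alpha> * real n ^ 2 + \<beta> * real (Suc k) ^ 2))" for n
    by (simp add: f_def lattice_kernel_def del: of_nat_Suc)
  have G0: "G \<ge> 0" using order_trans[OF norm_ge_zero G] .
  have "norm (\<Sum>i<m. g (int (l * m + Suc i)) * f (l * m + Suc i)) \<le> real m * G * M"
  proof (rule mean_zero_block_norm_le[OF mean G])
    fix n assume n: "l * m < n" "n \<le> l * m + m"
    have n': "real l * real m \<le> real n" "real n \<le> real l * real m + real m"
      using of_nat_mono[OF less_imp_le[OF n(1)], where 'a = real] of_nat_mono[OF n(2), where 'a = real] by simp_all
    have "norm (f n - f (l * m + m)) \<le> (real (l * m + m) - real n) / (\<alpha> * real n ^ 2)"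
      unfolding f of_real_diff[symmetric] norm_of_real
      using n n' by (intro odd_kernel_diff alpha beta) auto
    also have "\<dots> \<le> M"
      unfolding M_def using n n' alpha block_index_ge[OF m n(1)]
      by (intro frac_le mult_left_mono power_mono mult_pos_pos) auto
    finally show "norm (f n - f (l * m + m)) \<le> M" .
  qed
  hence "norm (\<Sum>i<m. (g (int (l * m + Suc i)) * of_nat (l * m + Suc i)) * lattice_kernel \<alpha> \<beta> (l * m + Suc i) (Suc k)) \<le> real m * G * M"
    by (simp only: f_def mult.assoc)
  moreover have "real (Suc k) ^ 2 \<le> real (Suc k) ^ (2 * q)" using q by (intro power_increasing) auto
  ultimately have "norm (\<Sum>i<m. (g (int (l * m + Suc i)) * of_nat (l * m + Suc i)) * lattice_kernel \<alpha> \<beta> (l * m + Suc i) (Suc k))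
            / real (Suc k) ^ (2 * q) \<le> real m * G * M / real (Suc k) ^ 2"
    using alpha G0 by (intro frac_le) (auto simp: M_def)
  also have "\<dots> = (real m * G * (real m / \<alpha>)) * (1 / real (Suc l) ^ 2) * (1 / real (Suc k) ^ 2)"
    by (simp add: M_def del: of_nat_Suc)
  finally show ?thesis .
qed

text \<open>For q > 0 the single terms are already small enough, at most G/(\<alpha> n^2 k^2), so no
  cancellation is used and the mean of \<open>g\<close> is arbitrary.\<close>

lemma even_kernel_bound:
  assumes G: "\<And>n. norm (g (int n)) \<le> G" and q: "q > 0"
  shows "norm (\<Sum>i<m. g (int (l * m + Suc i)) * lattice_kernel \<alpha> \<beta> (l * m + Suc i) (Suc k))
            / real (Suc k) ^ (2 * q) \<le> (real m * G / \<alpha>) * (1 / real (Suc l) ^ 2) * (1 / real (Suc k) ^ 2)"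
proof -
  define M where "M = 1 / (\<alpha> * real (Suc l) ^ 2)"
  have G0: "G \<ge> 0" using order_trans[OF norm_ge_zero G] .
  have "norm (\<Sum>i<m. g (int (l * m + Suc i)) * lattice_kernel \<alpha> \<beta> (l * m + Suc i) (Suc k)) \<le> real m * G * M"
  proof (rule periodic_block_norm_le[of g G, OF G])
    fix i assume "i < m"
    have "norm (lattice_kernel \<alpha> \<beta> (l * m + Suc i) (Suc k)) = 1 / (\<alpha> * real (l * m + Suc i) ^ 2 + \<beta> * real (Suc k) ^ 2)"
      unfolding lattice_kernel_def norm_divide norm_of_real norm_one
      using alpha beta by (intro arg_cong2[of _ _ _ _ "(/)"] refl abs_of_nonneg add_nonneg_nonneg) auto
    also have "\<dots> \<le> M"
    proof -
      have "real (Suc l) ^ 2 \<le> real (l * m + Suc i) ^ 2" 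
        using m by (intro power_mono block_index_ge) auto
      hence "\<alpha> * real (Suc l) ^ 2 \<le> \<alpha> * real (l * m + Suc i) ^ 2 + \<beta> * real (Suc k) ^ 2"
        using alpha beta by (intro add_increasing2 mult_left_mono) auto
      moreover have "0 < \<alpha> * real (Suc l) ^ 2" using alpha by simp
      ultimately show ?thesis unfolding M_def by (intro frac_le) simp_all
    qed
    finally show "norm (lattice_kernel \<alpha> \<beta> (l * m + Suc i) (Suc k)) \<le> M" .
  qed
  moreover have "real (Suc k) ^ 2 \<le> real (Suc k) ^ (2 * q)" using q by (intro power_increasing) auto
  ultimately have "norm (\<Sum>i<m. g (int (l * m + Suc i)) * lattice_kernel \<alpha> \<beta> (l * m + Suc i) (Suc k))
            / real (Suc k) ^ (2 * q) \<le> real m * G * M / real (Suc k) ^ 2"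
    using alpha G0 by (intro frac_le) (auto simp: M_def)
  also have "\<dots> = (real m * G / \<alpha>) * (1 / real (Suc l) ^ 2) * (1 / real (Suc k) ^ 2)"
    by (simp add: M_def del: of_nat_Suc)
  finally show ?thesis .
qed

text \<open>Without a power of k in front, the constant bound on D(n,k) k^0 in k would not be
  summable; the zero mean allows the passage to kernel differences, which decay like the power 3/2
  in each variable.\<close>

lemma even_kernel_bound_mean_zero:
  assumes mean: "periodic_mean m g = 0" and G: "\<And>n. norm (g (int n)) \<le> G"
  shows "norm (\<Sum>i<m. g (int (l * m + Suc i)) * lattice_kernel \<alpha> \<beta> (l * m + Suc i) (Suc k))
      \<le> (real m * G * (\<alpha> * real m / (pi * sqrt (2 * pi * \<alpha>)))) * (1 / sqrt (real (Suc l) ^ 3)) * (1 / sqrt (real (Suc k) ^ 3))"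
proof -
  define f where "f n = lattice_kernel \<alpha> \<beta> n (Suc k)" for n
  define M where "M = \<alpha> * real m / (pi * sqrt (2 * pi * \<alpha>)) * (1 / sqrt (real (Suc l) ^ 3) * (1 / sqrt (real (Suc k) ^ 3)))"
  have f: "f n = of_real (1 / (\<alpha> * real n ^ 2 + \<beta> * real (Suc k) ^ 2))" for n
    by (simp add: f_def lattice_kernel_def del: of_nat_Suc)
  have "norm (\<Sum>i<m. g (int (l * m + Suc i)) * f (l * m + Suc i)) \<le> real m * G * M"
  proof (rule mean_zero_block_norm_le[OF mean G])
    fix n assume n: "l * m < n" "n \<le> l * m + m"
    have n': "real l * real m \<le> real n" "real n \<le> real l * real m + real m"
      using of_nat_mono[OF less_imp_le[OF n(1)], where 'a = real] of_nat_mono[OF n(2), where 'a = real] by simp_all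
    have "norm (f n - f (l * m + m)) \<le> \<alpha> * (real (l * m + m) - real n) / (pi * sqrt (2 * pi * \<alpha>)) *
        (1 / sqrt (real n ^ 3) * (1 / sqrt (real (Suc k) ^ 3)))"
      unfolding f of_real_diff[symmetric] norm_of_real
      using n n'
      by (intro even_kernel_diff alpha beta alpha_beta) auto
    also have "\<dots> \<le> M"
    proof -
      have "sqrt (real (Suc l) ^ 3) \<le> sqrt (real n ^ 3)"
        using block_index_ge[OF m n(1)] by (intro real_sqrt_le_mono power_mono) auto
      thus ?thesis
        unfolding M_def using n n' alpha
        by (intro mult_mono divide_right_mono mult_left_mono divide_left_mono mult_nonneg_nonneg divide_nonneg_nonneg mult_pos_pos)
           auto
    qed
    finally show "norm (f n - f (l * m + m)) \<le> M" .
  qed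
  thus ?thesis by (simp add: f_def M_def del: of_nat_Suc)
qed

end

section \<open>Columns: the sum over n for fixed k\<close>

locale periodic_conjugate_root =
  periodic_conjugate m g \<alpha> \<beta> + periodic_function_root m g \<omega> for m g \<alpha> \<beta> \<omega>
begin

text \<open>The columns deliver the finite sum over residues inside the series, while the theorem
  has it outside; each residue gives a convergent series, so the two may be exchanged.\<close>

lemma twisted_series_sums:
  assumes "p \<ge> 1"
  shows "(\<lambda>n. twisted_sum m g \<beta> \<omega> (Suc n) / of_nat (Suc n) ^ p) sums
           (\<Sum>r<m. g (int r) * (\<Sum>n. 1 / of_nat (Suc n) ^ p / (exp (2 * of_nat (Suc n) * of_real \<beta> / of_nat m) * \<omega> ^ r - 1)))"
proof -
  have "(\<lambda>n. 1 / of_nat (Suc n) ^ p / (exp (2 * of_nat (Suc n) * of_real \<beta> / of_nat m) * \<omega> ^ r - 1)) sums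
        (\<Sum>n. 1 / of_nat (Suc n) ^ p / (exp (2 * of_nat (Suc n) * of_real \<beta> / of_nat m) * \<omega> ^ r - 1))" for r
  proof -
    have "summable (\<lambda>n. 1 / of_nat (Suc n) ^ p / (exp (of_real (2 * \<beta> / m * real (Suc n))) * \<omega> ^ r - 1))"
      using assms beta m
      by (intro summable_exp_denominator[where G = 1]) (auto simp: norm_power omega)
    moreover have "complex_of_real (2 * \<beta> / m * real (Suc n)) = 2 * of_nat (Suc n) * of_real \<beta> / of_nat m" for n
      by simp
    ultimately show ?thesis by (intro summable_sums) (simp only:)
  qed
  hence "(\<lambda>n. \<Sum>r<m. g (int r) * (1 / of_nat (Suc n) ^ p / (exp (2 * of_nat (Suc n) * of_real \<beta> / of_nat m) * \<omega> ^ r - 1))) sums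
           (\<Sum>r<m. g (int r) * (\<Sum>n. 1 / of_nat (Suc n) ^ p / (exp (2 * of_nat (Suc n) * of_real \<beta> / of_nat m) * \<omega> ^ r - 1)))"
    by (intro sums_sum sums_mult)
  thus ?thesis
    by (simp add: twisted_sum_def sum_divide_distrib mult_ac del: of_nat_Suc)
qed

lemma odd_kernel_column:
  assumes odd: "\<And>n. g (- n) = - g n" and mean: "periodic_mean m g = 0"
  shows "(\<lambda>l. \<Sum>i<m. (g (int (l * m + Suc i)) * of_nat (l * m + Suc i)) * lattice_kernel \<alpha> \<beta> (l * m + Suc i) (Suc k)) sums
           (1 / of_real \<alpha> * (\<i> * of_real pi / of_nat m * twisted_sum m g \<beta> \<omega> (Suc k)))"
proof -
  \<comment> \<open>With this \<open>c\<close> the exponent 2 pi c/m is 2 k \<beta>/m.\<close>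
  define c where "c = \<beta> * real (Suc k) / pi"
  have c: "c > 0" using beta by (simp add: c_def)
  have "(\<lambda>l. 1 / of_real \<alpha> * (\<Sum>i<m. g (int (Suc i)) * (of_nat (l * m + Suc i) / of_real (real (l * m + Suc i) ^ 2 + c\<^sup>2)))) sums
          (1 / of_real \<alpha> * (\<i> * of_real pi / of_nat m * twisted_sum m g \<beta> \<omega> (Suc k)))"
    unfolding twisted_sum_alt[symmetric] c_def[symmetric]
    by (intro sums_mult odd_block_sums[OF c odd mean])
  moreover have "1 / of_real \<alpha> * (\<Sum>i<m. g (int (Suc i)) * (of_nat (l * m + Suc i) / of_real (real (l * m + Suc i) ^ 2 + c\<^sup>2)))
     = (\<Sum>i<m. (g (int (l * m + Suc i)) * of_nat (l * m + Suc i)) * lattice_kernel \<alpha> \<beta> (l * m + Suc i) (Suc k))" for l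
    unfolding kernel_scaled c_def[symmetric] sum_distrib_left periodic_nat_shift[of g m, OF periodic]
    by (intro sum.cong refl) (simp del: of_nat_Suc of_nat_add)
  ultimately show ?thesis by (simp only:)
qed

text \<open>By \<open>\<alpha> * \<beta> = pi\<^sup>2\<close> the prefactor pi/(\<alpha> c) is 1/k,
  and g(0)/(2 \<alpha> c^2) is g(0)/(2 \<beta> k^2), half of the kernel term at n = 0.\<close>

lemma even_kernel_column:
  assumes even: "\<And>n. g (- n) = g n"
  shows "(\<lambda>l. \<Sum>i<m. g (int (l * m + Suc i)) * lattice_kernel \<alpha> \<beta> (l * m + Suc i) (Suc k)) sums
           ((periodic_mean m g / 2 + 1 / of_nat m * twisted_sum m g \<beta> \<omega> (Suc k)) / of_nat (Suc k)
             - g 0 / of_real (2 * \<beta>) / of_nat (Suc k) ^ 2)"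
proof -
  define c where "c = \<beta> * real (Suc k) / pi"
  have c: "c > 0" using beta by (simp add: c_def)
  have "(\<lambda>l. 1 / of_real \<alpha> * (\<Sum>i<m. g (int (Suc i)) * (1 / of_real (real (l * m + Suc i) ^ 2 + c\<^sup>2)))) sums
          (1 / of_real \<alpha> * (of_real (pi / c) * (periodic_mean m g / 2 + 1 / of_nat m * twisted_sum m g \<beta> \<omega> (Suc k)) - g 0 / of_real (2 * c\<^sup>2)))"
    unfolding twisted_sum_alt[symmetric] c_def[symmetric]
    by (intro sums_mult even_block_sums[OF c even])
  moreover have "1 / of_real \<alpha> * (\<Sum>i<m. g (int (Suc i)) * (1 / of_real (real (l * m + Suc i) ^ 2 + c\<^sup>2)))
     = (\<Sum>i<m. g (int (l * m + Suc i)) * lattice_kernel \<alpha> \<beta> (l * m + Suc i) (Suc k))" for l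
    unfolding kernel_scaled c_def[symmetric] sum_distrib_left periodic_nat_shift[of g m, OF periodic]
    by (intro sum.cong refl) (simp del: of_nat_Suc of_nat_add)
  moreover have "1 / of_real \<alpha> * (of_real (pi / c) * X - g 0 / of_real (2 * c\<^sup>2)) =
      X / of_nat (Suc k) - g 0 / of_real (2 * \<beta>) / of_nat (Suc k) ^ 2" for X :: complex
  proof -
    have "pi / c = (\<alpha> * \<beta>) / (\<beta> * real (Suc k))"
      unfolding c_def alpha_beta by (simp add: power2_eq_square)
    hence 1: "pi / c = \<alpha> / real (Suc k)" using beta by simp
    have "c\<^sup>2 = (\<beta> * real (Suc k))\<^sup>2 / (\<alpha> * \<beta>)" by (simp only: c_def power_divide alpha_beta)
    hence 2: "2 * c\<^sup>2 = 2 * \<beta> * real (Suc k) ^ 2 / \<alpha>"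
      using alpha beta by (simp add: power2_eq_square)
    show ?thesis unfolding 1 2 using alpha beta by (simp add: right_diff_distrib del: of_nat_Suc)
  qed
  ultimately show ?thesis by (simp only:)
qed

lemma odd_identity:
  assumes odd: "\<And>n. g (- n) = - g n" and mean: "periodic_mean m g = 0" and q: "q > 0"
  shows "1 / 2 * dirichlet_L (of_nat (2 * q)) g + exp_series g \<alpha> (2 * q) =
     (\<Sum>j=0..q. zeta_coeff \<alpha> \<beta> j * dirichlet_L (of_nat (2 * (q - j) + 1)) g) +
     of_real (- \<alpha> / \<beta>) ^ q * (1 / of_real \<alpha> * (\<i> * of_real pi / of_nat m) *
       (\<Sum>r<m. g (int r) * (\<Sum>n. 1 / of_nat (Suc n) ^ (2 * q) / (exp (2 * of_nat (Suc n) * of_real \<beta> / of_nat m) * \<omega> ^ r - 1))))"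
proof -
  obtain G where G: "G > 0" "\<And>n. norm (g (int n)) \<le> G" using periodic_bounded[of m g, OF m periodic] by blast
  define V where "V k = 1 / of_real \<alpha> * (\<i> * of_real pi / of_nat m * twisted_sum m g \<beta> \<omega> (Suc k))" for k
  have main: "1 / 2 * dirichlet_L (of_nat (2 * q)) g + exp_series g \<alpha> (2 * q) =
     (\<Sum>j=0..q. zeta_coeff \<alpha> \<beta> j * dirichlet_L (of_nat (2 * (q - j) + 1)) g) +
     of_real (- \<alpha> / \<beta>) ^ q * (\<Sum>k. V k / of_nat (Suc k) ^ (2 * q))"
  \<comment> \<open>The factor n in the weight lowers the exponents 2(q-j)+2 and 2q+1 by one. At j =
    q this leads to L(1,g), whose convergence rests on the zero mean.\<close>
  proof (rule lattice_sum_swap[OF m, where w = "\<lambda>n. g (int n) * of_nat n"])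
    fix j assume "j \<le> q"
    have "(\<lambda>n. g (int (Suc n)) / of_nat (Suc n) ^ (2 * (q - j) + 1)) sums dirichlet_L (of_nat (2 * (q - j) + 1)) g"
      by (rule dirichlet_L_of_nat_sums) (use mean in auto)
    thus "(\<lambda>n. g (int (Suc n)) * of_nat (Suc n) / of_nat (Suc n) ^ (2 * (q - j) + 2)) sums
            dirichlet_L (of_nat (2 * (q - j) + 1)) g"
      by (simp del: of_nat_Suc of_nat_mult of_nat_add)
  next
    have "(\<lambda>n. g (int (Suc n)) * bernoulli_factor \<alpha> (Suc n) / of_nat (Suc n) ^ (2 * q)) sums
           (1 / 2 * dirichlet_L (of_nat (2 * q)) g + exp_series g \<alpha> (2 * q))"
      by (rule bernoulli_series_sums) (use q in auto)
    thus "(\<lambda>n. g (int (Suc n)) * of_nat (Suc n) * bernoulli_factor \<alpha> (Suc n) / of_nat (Suc n) ^ (2 * q + 1)) sums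
           (1 / 2 * dirichlet_L (of_nat (2 * q)) g + exp_series g \<alpha> (2 * q))"
      by (simp del: of_nat_Suc of_nat_mult of_nat_add)
  next
    show "norm (\<Sum>i<m. (g (int (l * m + Suc i)) * of_nat (l * m + Suc i)) * lattice_kernel \<alpha> \<beta> (l * m + Suc i) (Suc k))
            / real (Suc k) ^ (2 * q) \<le> (real m * G * (real m / \<alpha>)) * (1 / real (Suc l) ^ 2) * (1 / real (Suc k) ^ 2)" for l k
      by (rule odd_kernel_bound[OF mean G(2) q])
    show "(\<lambda>l. \<Sum>i<m. (g (int (l * m + Suc i)) * of_nat (l * m + Suc i)) * lattice_kernel \<alpha> \<beta> (l * m + Suc i) (Suc k)) sums V k" for k
      unfolding V_def by (rule odd_kernel_column[OF odd mean])
    show "summable (\<lambda>l. (real m * G * (real m / \<alpha>)) * (1 / real (Suc l) ^ 2))"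
      by (intro summable_mult summable_Suc_power) simp
    show "summable (\<lambda>k. 1 / real (Suc k) ^ 2)" by (rule summable_Suc_power) simp
  qed (use G alpha in auto)
  have "(\<lambda>k. 1 / of_real \<alpha> * (\<i> * of_real pi / of_nat m) * (twisted_sum m g \<beta> \<omega> (Suc k) / of_nat (Suc k) ^ (2 * q))) sums
    (1 / of_real \<alpha> * (\<i> * of_real pi / of_nat m) * 
      (\<Sum>r<m. g (int r) * (\<Sum>n. 1 / of_nat (Suc n) ^ (2 * q) / (exp (2 * of_nat (Suc n) * of_real \<beta> / of_nat m) * \<omega> ^ r - 1))))"
    by (intro sums_mult twisted_series_sums) (use q in auto)
  hence "(\<lambda>k. V k / of_nat (Suc k) ^ (2 * q)) sums (1 / of_real \<alpha> * (\<i> * of_real pi / of_nat m) * 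
      (\<Sum>r<m. g (int r) * (\<Sum>n. 1 / of_nat (Suc n) ^ (2 * q) / (exp (2 * of_nat (Suc n) * of_real \<beta> / of_nat m) * \<omega> ^ r - 1))))"
    by (simp add: V_def mult_ac del: of_nat_Suc)
  from main[unfolded sums_unique[OF this, symmetric]] show ?thesis .
qed

text \<open>The term with \<zeta>(2q+2) is kept apart from the sum over \<open>j\<close>: it comes
  from the columns and becomes the summand j = q + 1 only through the value of L(0,g).\<close>

lemma even_identity:
  assumes even: "\<And>n. g (- n) = g n" and q: "q > 0 \<or> periodic_mean m g = 0"
  shows "1 / 2 * dirichlet_L (of_nat (2 * q + 1)) g + exp_series g \<alpha> (2 * q + 1) =
     (\<Sum>j=0..q. zeta_coeff \<alpha> \<beta> j * dirichlet_L (of_nat (2 * (q - j) + 2)) g) +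
     of_real (- \<alpha> / \<beta>) ^ q * ((if q = 0 then 0 else 1 / 2 * periodic_mean m g * riemann_zeta (of_nat (2 * q + 1)))
       + 1 / of_nat m *
       (\<Sum>r<m. g (int r) * (\<Sum>n. 1 / of_nat (Suc n) ^ (2 * q + 1) / (exp (2 * of_nat (Suc n) * of_real \<beta> / of_nat m) * \<omega> ^ r - 1)))
       - g 0 / of_real (2 * \<beta>) * riemann_zeta (of_nat (2 * q + 2)))"
proof -
  obtain G where G: "G > 0" "\<And>n. norm (g (int n)) \<le> G" using periodic_bounded[of m g, OF m periodic] by blast
  define M where "M = periodic_mean m g"
  define T where "T = twisted_sum m g \<beta> \<omega>"
  define V where "V k = (M / 2 + 1 / of_nat m * T (Suc k)) / of_nat (Suc k)
             - g 0 / of_real (2 * \<beta>) / of_nat (Suc k) ^ 2" for k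
  define X where "X = (\<Sum>r<m. g (int r) * (\<Sum>n. 1 / of_nat (Suc n) ^ (2 * q + 1) / (exp (2 * of_nat (Suc n) * of_real \<beta> / of_nat m) * \<omega> ^ r - 1)))"
  have Lam: "(\<lambda>n. g (int (Suc n)) / of_nat (Suc n) ^ (2 * (q - j) + 2)) sums dirichlet_L (of_nat (2 * (q - j) + 2)) g" for j
    by (rule dirichlet_L_of_nat_sums) auto
  have S: "(\<lambda>n. g (int (Suc n)) * bernoulli_factor \<alpha> (Suc n) / of_nat (Suc n) ^ (2 * q + 1)) sums
           (1 / 2 * dirichlet_L (of_nat (2 * q + 1)) g + exp_series g \<alpha> (2 * q + 1))"
    by (rule bernoulli_series_sums) (use q in auto)
  have col: "(\<lambda>l. \<Sum>i<m. g (int (l * m + Suc i)) * lattice_kernel \<alpha> \<beta> (l * m + Suc i) (Suc k)) sums V k" for k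
    unfolding V_def M_def T_def by (rule even_kernel_column[OF even])
  have main: "1 / 2 * dirichlet_L (of_nat (2 * q + 1)) g + exp_series g \<alpha> (2 * q + 1) =
     (\<Sum>j=0..q. zeta_coeff \<alpha> \<beta> j * dirichlet_L (of_nat (2 * (q - j) + 2)) g) +
     of_real (- \<alpha> / \<beta>) ^ q * (\<Sum>k. V k / of_nat (Suc k) ^ (2 * q))"
  \<comment> \<open>The cases differ only in the majorant: squares for q > 0, powers 3/2 and the
    zero mean for q = 0.\<close>
  proof (cases "q = 0")
    case False
    have bound: "norm (\<Sum>i<m. g (int (l * m + Suc i)) * lattice_kernel \<alpha> \<beta> (l * m + Suc i) (Suc k))
            / real (Suc k) ^ (2 * q) \<le> (real m * G / \<alpha>) * (1 / real (Suc l) ^ 2) * (1 / real (Suc k) ^ 2)" for l k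
      by (rule even_kernel_bound[OF G(2)]) (use False in auto)
    have sq: "summable (\<lambda>k. 1 / real (Suc k) ^ 2)" by (rule summable_Suc_power) simp
    show ?thesis
      by (rule lattice_sum_swap[OF m, where w = "\<lambda>n. g (int n)",
            OF Lam S bound summable_mult[OF sq] sq _ _ col])
         (use G alpha in auto)
  next
    case True
    have bound: "norm (\<Sum>i<m. g (int (l * m + Suc i)) * lattice_kernel \<alpha> \<beta> (l * m + Suc i) (Suc k)) / real (Suc k) ^ (2 * q)
      \<le> (real m * G * (\<alpha> * real m / (pi * sqrt (2 * pi * \<alpha>)))) * (1 / sqrt (real (Suc l) ^ 3)) * (1 / sqrt (real (Suc k) ^ 3))" for l k
      using even_kernel_bound_mean_zero[OF _ G(2), of l k] q True by simp
    show ?thesis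
      by (rule lattice_sum_swap[OF m, where w = "\<lambda>n. g (int n)",
            OF Lam S bound summable_mult[OF summable_sqrt_cube] summable_sqrt_cube _ _ col])
         (use G alpha in auto)
  qed
  have "(\<lambda>k. T (Suc k) / of_nat (Suc k) ^ (2 * q + 1)) sums X"
    unfolding T_def X_def by (intro twisted_series_sums) auto
  hence 1: "(\<lambda>k. 1 / of_nat m * (T (Suc k) / of_nat (Suc k) ^ (2 * q + 1))) sums (1 / of_nat m * X)"
    by (rule sums_mult)
  have 2: "(\<lambda>k. M / 2 * (1 / of_nat (Suc k) ^ (2 * q + 1))) sums
      (if q = 0 then 0 else 1 / 2 * M * riemann_zeta (of_nat (2 * q + 1)))"
  \<comment> \<open>For q = 0 the hypothesis forces \<open>M = 0\<close>, so what would be a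
    harmonic series has only zero terms; this is the convention for the term with
    \<zeta>(1).\<close>
  proof (cases "q = 0")
    case True
    thus ?thesis using q by (simp add: M_def)
  next
    case False
    have "(\<lambda>k. M / 2 * (1 / of_nat (Suc k) ^ (2 * q + 1))) sums (M / 2 * riemann_zeta (of_nat (2 * q + 1)))"
      by (intro sums_mult riemann_zeta_of_nat_sums) (use False in auto)
    thus ?thesis using False by simp
  qed
  have 3: "(\<lambda>k. g 0 / of_real (2 * \<beta>) * (1 / of_nat (Suc k) ^ (2 * q + 2))) sums
      (g 0 / of_real (2 * \<beta>) * riemann_zeta (of_nat (2 * q + 2)))"
    by (intro sums_mult riemann_zeta_of_nat_sums) auto
  have "V k / of_nat (Suc k) ^ (2 * q) = M / 2 * (1 / of_nat (Suc k) ^ (2 * q + 1)) +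
      1 / of_nat m * (T (Suc k) / of_nat (Suc k) ^ (2 * q + 1)) - g 0 / of_real (2 * \<beta>) * (1 / of_nat (Suc k) ^ (2 * q + 2))" for k
    unfolding V_def
    by (simp add: diff_divide_distrib add_divide_distrib power_add power2_eq_square mult_ac del: of_nat_Suc)
  with sums_diff[OF sums_add[OF 2 1] 3]
  have "(\<lambda>k. V k / of_nat (Suc k) ^ (2 * q)) sums ((if q = 0 then 0 else 1 / 2 * M * riemann_zeta (of_nat (2 * q + 1)))
        + 1 / of_nat m * X - g 0 / of_real (2 * \<beta>) * riemann_zeta (of_nat (2 * q + 2)))"
    by (simp only:)
  from main[unfolded sums_unique[OF this, symmetric]] show ?thesis
    unfolding X_def M_def .
qed

end

section \<open>Rescaling the two identities to the stated powers of \<alpha> and \<beta>\<close>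

theorem theorem1:
  fixes m q :: nat and g :: "int \<Rightarrow> complex" and \<alpha> \<beta> :: real and \<omega> :: complex
  assumes m: "m > 0"
    and omega: "\<omega> = exp (2 * of_real pi * \<i> / of_nat m)"
    and periodic: "\<And>n. g (n + int m) = g n"
    and alpha: "\<alpha> > 0" and beta: "\<beta> > 0" and alpha_beta: "\<alpha> * \<beta> = pi\<^sup>2"
  shows
    "(q > 0 \<and> (\<forall>n. g (- n) = - g n) \<longrightarrow>
       of_real (\<alpha> powr (- real q + 1/2)) *
         (1/2 * dirichlet_L (2 * of_nat q) g +
          (\<Sum>n. of_nat (Suc n) powi (- 2 * int q) * g (int (Suc n)) /
               (exp (2 * of_nat (Suc n) * of_real \<alpha>) - 1)))
     = (-1) ^ q * of_real (\<beta> powr (- real q + 1/2)) * \<i> * inverse (of_nat m) *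
         (\<Sum>k=1..<m. g (int k) *
            (\<Sum>n. of_nat (Suc n) powi (- 2 * int q) /
                 (exp (2 * of_nat (Suc n) * of_real \<beta> / of_nat m) * \<omega> ^ k - 1)))
       + (\<Sum>j=0..q. (-1) ^ (j + 1) * of_real (\<alpha> powr (real j - 1/2 - real q)) *
            of_real (\<beta> powi (- int j)) * riemann_zeta (2 * of_nat j) *
            dirichlet_L (2 * of_nat q - 2 * of_nat j + 1) g))
     \<and>
     ((q > 0 \<or> periodic_mean m g = 0) \<and> (\<forall>n. g (- n) = g n) \<longrightarrow>
       of_real (\<alpha> powi (- int q)) *
         (1/2 * dirichlet_L (2 * of_nat q + 1) g +
          (\<Sum>n. of_nat (Suc n) powi (- 2 * int q - 1) * g (int (Suc n)) /
               (exp (2 * of_nat (Suc n) * of_real \<alpha>) - 1)))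
     = of_real ((- \<beta>) powi (- int q)) *
         ((if q = 0 then 0 else 1/2 * periodic_mean m g * riemann_zeta (2 * of_nat q + 1)) +
          1 / of_nat m *
          (\<Sum>k=0..<m. g (int k) *
             (\<Sum>n. of_nat (Suc n) powi (- 2 * int q - 1) /
                  (exp (2 * of_nat (Suc n) * of_real \<beta> / of_nat m) * \<omega> ^ k - 1))))
       + (\<Sum>j=0..q+1. (-1) ^ (j + 1) * of_real (\<alpha> powi (int j - int q - 1)) *
            of_real (\<beta> powi (- int j)) * riemann_zeta (2 * of_nat j) *
            dirichlet_L (2 * of_nat q - 2 * of_nat j + 2) g))"
proof (intro conjI impI)
  interpret S: periodic_conjugate_root m g \<alpha> \<beta> \<omega>
    using assms by unfold_locales auto
  have powi_even: "(of_nat (Suc n) :: complex) powi (- 2 * int q) = 1 / of_nat (Suc n) ^ (2 * q)" for n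
    unfolding mult_minus_left power_int_minus
    by (metis inverse_eq_divide of_nat_mult of_nat_numeral power_int_of_nat)
  have powi_odd: "(of_nat (Suc n) :: complex) powi (- 2 * int q - 1) = 1 / of_nat (Suc n) ^ (2 * q + 1)" for n
  proof -
    have "- 2 * int q - 1 = - int (2 * q + 1)" by simp
    thus ?thesis by (simp only: power_int_minus power_int_of_nat inverse_eq_divide)
  qed
  have arg: "(2 * of_nat q - 2 * of_nat j :: complex) = of_nat (2 * (q - j))" if "j \<le> q" for j
    using that by (simp add: of_nat_diff algebra_simps)
  have zeta_arg: "(2 * of_nat j :: complex) = of_nat (2 * j)" for j by simp
  have beta_powi: "\<beta> powi (- int j) = 1 / \<beta> ^ j" for j
    by (simp add: power_int_minus inverse_eq_divide)
  {
    assume asm: "q > 0 \<and> (\<forall>n. g (- n) = - g n)"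
    hence odd: "\<And>n. g (- n) = - g n" and q: "q > 0" by auto
    have mean: "periodic_mean m g = 0" by (rule S.odd_periodic_mean[OF odd])
    define Z where "Z = (\<lambda>r. \<Sum>n. 1 / of_nat (Suc n) ^ (2 * q) / (exp (2 * of_nat (Suc n) * of_real \<beta> / of_nat m) * \<omega> ^ r - 1))"
    define A where "A = \<alpha> powr (- real q + 1/2)"
    have g0: "g 0 = 0" using odd[of 0] by simp
    \<comment> \<open>For odd \<open>g\<close> the residue 0 drops out, which is why the stated sum
      starts at k = 1.\<close>
    have Zsum: "(\<Sum>r<m. g (int r) * Z r) = (\<Sum>k=1..<m. g (int k) * Z k)"
      using m by (simp add: lessThan_atLeast0 sum.atLeast_Suc_lessThan g0)
    \<comment> \<open>The columns contribute pi/\<alpha>, and pi is the product of the square roots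
      of \<alpha> and \<beta>. Multiplying by \<alpha>^(1/2) turns this into \<beta>^(1/2), the
      source of the half-integral powers in the odd case.\<close>
    have c1: "A * (\<alpha> / \<beta>) ^ q * (pi / \<alpha>) = \<beta> powr (- real q + 1/2)"
    proof -
      define a where "a = \<alpha> powr (1/2)"
      define b where "b = \<beta> powr (1/2)"
      have a: "a > 0" "a * a = \<alpha>" using alpha by (simp_all add: a_def powr_add[symmetric])
      have "pi = sqrt (\<alpha> * \<beta>)" unfolding alpha_beta by simp
      hence pi: "pi = a * b"
        using alpha beta by (simp add: a_def b_def powr_half_sqrt real_sqrt_mult)
      have "x powr (- real q + 1/2) = x powr (1/2) / x ^ q" if "x > 0" for x
        by (simp only: powr_add powr_minus powr_realpow[OF that] divide_inverse mult.commute)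
      hence half: "A = a / \<alpha> ^ q" "\<beta> powr (- real q + 1/2) = b / \<beta> ^ q"
        using alpha beta by (simp_all only: A_def a_def b_def)
      have "A * (\<alpha> / \<beta>) ^ q * (pi / \<alpha>) = a / \<alpha> ^ q * (\<alpha> ^ q / \<beta> ^ q) * (a * b / (a * a))"
        by (simp only: half pi a(2) power_divide)
      also have "\<dots> = b / \<beta> ^ q" using a(1) alpha by simp
      finally show ?thesis by (simp only: half)
    qed
    have c2: "A * (\<alpha> ^ j / (\<alpha> * \<beta> ^ j)) = \<alpha> powr (real j - 1/2 - real q) * \<beta> powi (- int j)" for j
    proof -
      have "\<alpha> powr (real j - 1/2 - real q) = A * (\<alpha> ^ j / \<alpha>)"
      proof -
        have e: "real j - 1/2 - real q = (- real q + 1/2) + (real j - 1)" by simp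
        show ?thesis unfolding e powr_add[of \<alpha> "- real q + 1/2"] powr_diff A_def[symmetric]
          using alpha by (simp add: powr_realpow)
      qed
      thus ?thesis by (simp add: beta_powi)
    qed
    have t1: "of_real A * (of_real (- \<alpha> / \<beta>) ^ q * (1 / of_real \<alpha> * (\<i> * of_real pi / of_nat m) * S)) =
       (-1) ^ q * of_real (\<beta> powr (- real q + 1/2)) * \<i> * inverse (of_nat m) * S" for S :: complex
    proof -
      have "of_real (- \<alpha> / \<beta>) ^ q = (-1) ^ q * complex_of_real ((\<alpha> / \<beta>) ^ q)"
        by (simp add: power_minus[of "of_real \<alpha> / of_real \<beta>"])
      thus ?thesis unfolding c1[symmetric] by (simp add: divide_inverse mult_ac)
    qed
    have t2: "of_real A * (zeta_coeff \<alpha> \<beta> j * dirichlet_L (of_nat (2 * (q - j) + 1)) g) =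
        (-1) ^ (j + 1) * of_real (\<alpha> powr (real j - 1/2 - real q)) *
            of_real (\<beta> powi (- int j)) * riemann_zeta (2 * of_nat j) *
            dirichlet_L (2 * of_nat q - 2 * of_nat j + 1) g" if "j \<in> {0..q}" for j
    proof -
      have "of_real A * zeta_coeff \<alpha> \<beta> j = (-1) ^ (j + 1) * of_real (A * (\<alpha> ^ j / (\<alpha> * \<beta> ^ j))) * riemann_zeta (of_nat (2 * j))"
        unfolding zeta_coeff_def of_real_mult by (simp only: mult_ac)
      also have "\<dots> = (-1) ^ (j + 1) * of_real (\<alpha> powr (real j - 1/2 - real q)) *
            of_real (\<beta> powi (- int j)) * riemann_zeta (2 * of_nat j)"
        unfolding c2 zeta_arg of_real_mult by (simp only: mult.assoc)
      finally have "of_real A * zeta_coeff \<alpha> \<beta> j = \<dots>" .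
      moreover have "(of_nat (2 * (q - j) + 1) :: complex) = 2 * of_nat q - 2 * of_nat j + 1"
        using that arg[of j] by simp
      ultimately show ?thesis by (simp only: mult.assoc[symmetric, of "of_real A"])
    qed
    have "of_real A * (1/2 * dirichlet_L (of_nat (2 * q)) g + exp_series g \<alpha> (2 * q)) =
        of_real A * (of_real (- \<alpha> / \<beta>) ^ q * (1 / of_real \<alpha> * (\<i> * of_real pi / of_nat m) * (\<Sum>r<m. g (int r) * Z r)))
        + (\<Sum>j=0..q. of_real A * (zeta_coeff \<alpha> \<beta> j * dirichlet_L (of_nat (2 * (q - j) + 1)) g))"
      unfolding S.odd_identity[OF odd mean q] Z_def
      by (simp only: distrib_left sum_distrib_left add.commute)
    also have "\<dots> = (-1) ^ q * of_real (\<beta> powr (- real q + 1/2)) * \<i> * inverse (of_nat m) * (\<Sum>k=1..<m. g (int k) * Z k)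
       + (\<Sum>j=0..q. (-1) ^ (j + 1) * of_real (\<alpha> powr (real j - 1/2 - real q)) *
            of_real (\<beta> powi (- int j)) * riemann_zeta (2 * of_nat j) *
            dirichlet_L (2 * of_nat q - 2 * of_nat j + 1) g)"
      unfolding t1 Zsum by (intro arg_cong2[of _ _ _ _ "(+)"] refl sum.cong t2)
    finally show "of_real (\<alpha> powr (- real q + 1/2)) *
         (1/2 * dirichlet_L (2 * of_nat q) g +
          (\<Sum>n. of_nat (Suc n) powi (- 2 * int q) * g (int (Suc n)) /
               (exp (2 * of_nat (Suc n) * of_real \<alpha>) - 1)))
     = (-1) ^ q * of_real (\<beta> powr (- real q + 1/2)) * \<i> * inverse (of_nat m) *
         (\<Sum>k=1..<m. g (int k) *
            (\<Sum>n. of_nat (Suc n) powi (- 2 * int q) /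
                 (exp (2 * of_nat (Suc n) * of_real \<beta> / of_nat m) * \<omega> ^ k - 1)))
       + (\<Sum>j=0..q. (-1) ^ (j + 1) * of_real (\<alpha> powr (real j - 1/2 - real q)) *
            of_real (\<beta> powi (- int j)) * riemann_zeta (2 * of_nat j) *
            dirichlet_L (2 * of_nat q - 2 * of_nat j + 1) g)"
      unfolding powi_even A_def Z_def exp_series_def
      by (simp only: times_divide_eq_left mult_1_left zeta_arg)
  next
    assume asm: "(q > 0 \<or> periodic_mean m g = 0) \<and> (\<forall>n. g (- n) = g n)"
    hence even: "\<And>n. g (- n) = g n" and q: "q > 0 \<or> periodic_mean m g = 0" by auto
    define Z where "Z = (\<lambda>r. \<Sum>n. 1 / of_nat (Suc n) ^ (2 * q + 1) / (exp (2 * of_nat (Suc n) * of_real \<beta> / of_nat m) * \<omega> ^ r - 1))"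
    define A where "A = \<alpha> powi (- int q)"
    define Y where "Y = (if q = 0 then 0 else 1 / 2 * periodic_mean m g * riemann_zeta (of_nat (2 * q + 1)))"
    have A: "A = 1 / \<alpha> ^ q" by (simp add: A_def power_int_minus inverse_eq_divide)
    have c1: "of_real A * of_real (- \<alpha> / \<beta>) ^ q = complex_of_real ((- \<beta>) powi (- int q))"
    proof -
      have "A * (- \<alpha> / \<beta>) ^ q = (- \<beta>) powi (- int q)"
        using alpha beta by (simp add: A power_int_minus inverse_eq_divide power_divide power_minus[of \<alpha>] power_minus[of \<beta>] field_simps)
           (simp add: power_mult_distrib[symmetric])
      thus ?thesis by (metis of_real_mult of_real_power)
    qed
    have c2: "A * (\<alpha> ^ j / (\<alpha> * \<beta> ^ j)) = \<alpha> powi (int j - int q - 1) * \<beta> powi (- int j)" for j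
    proof -
      have "\<alpha> powi (int j - int q - 1) = \<alpha> ^ j / \<alpha> ^ q / \<alpha>"
        using alpha by (simp add: power_int_diff)
      thus ?thesis by (simp add: beta_powi A)
    qed
    have z: "of_real A * zeta_coeff \<alpha> \<beta> j = (-1) ^ (j + 1) * of_real (\<alpha> powi (int j - int q - 1)) *
            of_real (\<beta> powi (- int j)) * riemann_zeta (2 * of_nat j)" for j
    proof -
      have "of_real A * zeta_coeff \<alpha> \<beta> j = (-1) ^ (j + 1) * of_real (A * (\<alpha> ^ j / (\<alpha> * \<beta> ^ j))) * riemann_zeta (of_nat (2 * j))"
        unfolding zeta_coeff_def of_real_mult by (simp only: mult_ac)
      also have "\<dots> = (-1) ^ (j + 1) * of_real (\<alpha> powi (int j - int q - 1)) *
            of_real (\<beta> powi (- int j)) * riemann_zeta (2 * of_nat j)"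
        unfolding c2 zeta_arg of_real_mult by (simp only: mult.assoc)
      finally show ?thesis .
    qed
    have t2: "of_real A * (zeta_coeff \<alpha> \<beta> j * dirichlet_L (of_nat (2 * (q - j) + 2)) g) =
        (-1) ^ (j + 1) * of_real (\<alpha> powi (int j - int q - 1)) *
            of_real (\<beta> powi (- int j)) * riemann_zeta (2 * of_nat j) *
            dirichlet_L (2 * of_nat q - 2 * of_nat j + 2) g" if "j \<in> {0..q}" for j
    proof -
      have "(of_nat (2 * (q - j) + 2) :: complex) = 2 * of_nat q - 2 * of_nat j + 2"
        using that arg[of j] by simp
      thus ?thesis by (simp only: mult.assoc[symmetric, of "of_real A"] z)
    qed
    \<comment> \<open>At j = q + 1 the power of \<alpha> is 1 and the argument of L is 0; the value
      -g(0)/2 supplies both the sign and the factor 1/2 of the correction from the columns.\<close>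
    have t3: "of_real A * of_real (- \<alpha> / \<beta>) ^ q * (- (g 0 / of_real (2 * \<beta>) * riemann_zeta (of_nat (2 * q + 2)))) =
        (-1) ^ (q + 1 + 1) * of_real (\<alpha> powi (int (q + 1) - int q - 1)) *
            of_real (\<beta> powi (- int (q + 1))) * riemann_zeta (2 * of_nat (q + 1)) *
            dirichlet_L (2 * of_nat q - 2 * of_nat (q + 1) + 2) g"
    proof -
      have "(2 * of_nat q - 2 * of_nat (q + 1) + 2 :: complex) = 0" by (simp add: algebra_simps)
      hence L0: "dirichlet_L (2 * of_nat q - 2 * of_nat (q + 1) + 2) g = - g 0 / 2"
        using dirichlet_L_0[of m g, OF m periodic even] by (simp only:)
      have pow: "(- \<beta>) powi (- int q) = (-1) ^ q / \<beta> ^ q"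
        using beta by (simp add: power_int_minus inverse_eq_divide power_minus[of \<beta>] field_simps)
      have pow': "\<beta> powi (- int (q + 1)) = 1 / (\<beta> ^ q * \<beta>)" unfolding beta_powi by simp
      have alpha_pow: "\<alpha> powi (int (q + 1) - int q - 1) = 1" by simp
      have "(2 * of_nat (q + 1) :: complex) = of_nat (2 * q + 2)" by simp
      hence zeta: "riemann_zeta (2 * of_nat (q + 1)) = riemann_zeta (of_nat (2 * q + 2))" by (simp only:)
      show ?thesis
        unfolding c1 L0 pow pow' alpha_pow zeta
        by (simp del: of_nat_add of_nat_mult of_nat_Suc add: mult_ac)
    qed
    have "of_real A * (1/2 * dirichlet_L (of_nat (2 * q + 1)) g + exp_series g \<alpha> (2 * q + 1)) =
        of_real A * of_real (- \<alpha> / \<beta>) ^ q * (Y + 1 / of_nat m * (\<Sum>r<m. g (int r) * Z r))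
        + ((\<Sum>j=0..q. of_real A * (zeta_coeff \<alpha> \<beta> j * dirichlet_L (of_nat (2 * (q - j) + 2)) g))
           + of_real A * of_real (- \<alpha> / \<beta>) ^ q * (- (g 0 / of_real (2 * \<beta>) * riemann_zeta (of_nat (2 * q + 2)))))"
      unfolding S.even_identity[OF even q] Z_def Y_def sum_distrib_left[symmetric, of "of_real A"]
      by (simp only: diff_conv_add_uminus distrib_left mult.assoc add_ac)
    also have "\<dots> = of_real ((- \<beta>) powi (- int q)) * (Y + 1 / of_nat m * (\<Sum>k=0..<m. g (int k) * Z k))
       + (\<Sum>j=0..q+1. (-1) ^ (j + 1) * of_real (\<alpha> powi (int j - int q - 1)) *
            of_real (\<beta> powi (- int j)) * riemann_zeta (2 * of_nat j) *
            dirichlet_L (2 * of_nat q - 2 * of_nat j + 2) g)"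
    proof -
      have "(\<Sum>j=0..q+1. f j) = (\<Sum>j=0..q. f j) + f (q + 1)" for f :: "nat \<Rightarrow> complex" by simp
      thus ?thesis unfolding c1 t3[unfolded c1] lessThan_atLeast0
        by (intro arg_cong2[of _ _ _ _ "(+)"] refl) (simp only: sum.cong[OF refl t2])
    qed
    finally show "of_real (\<alpha> powi (- int q)) *
         (1/2 * dirichlet_L (2 * of_nat q + 1) g +
          (\<Sum>n. of_nat (Suc n) powi (- 2 * int q - 1) * g (int (Suc n)) /
               (exp (2 * of_nat (Suc n) * of_real \<alpha>) - 1)))
     = of_real ((- \<beta>) powi (- int q)) *
         ((if q = 0 then 0 else 1/2 * periodic_mean m g * riemann_zeta (2 * of_nat q + 1)) +
          1 / of_nat m *
          (\<Sum>k=0..<m. g (int k) *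
             (\<Sum>n. of_nat (Suc n) powi (- 2 * int q - 1) /
                  (exp (2 * of_nat (Suc n) * of_real \<beta> / of_nat m) * \<omega> ^ k - 1))))
       + (\<Sum>j=0..q+1. (-1) ^ (j + 1) * of_real (\<alpha> powi (int j - int q - 1)) *
            of_real (\<beta> powi (- int j)) * riemann_zeta (2 * of_nat j) *
            dirichlet_L (2 * of_nat q - 2 * of_nat j + 2) g)"
      unfolding powi_odd A_def Z_def Y_def exp_series_def
      by (simp only: times_divide_eq_left mult_1_left of_nat_add of_nat_mult of_nat_1 of_nat_numeral)
  }
qed

end
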